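(* Let $\alpha=(V,\mathrm{init},\mathrm{tcp},E,\mathrm{term},h)$ be an atomic hierarchical hybrid automaton of depth $2$ such that $h(v)$ is a flat automaton for every $v\in\mathrm{dom}(h)$. Let $\mathrm{enc}(\alpha)=(\hat V,\widehat{\mathrm{init}},\widehat{\mathrm{tcp}},\hat E,\widehat{\mathrm{term}},\emptyset)$ be the flat automaton defined in the context. Then $\alpha$ and $\mathrm{enc}(\alpha)$ are stateless bisimilar: $\alpha\cong\mathrm{enc}(\alpha)$.
   Context: Fix a set $\mathcal{L}$ of locations, a set $\mathcal{A}$ of actions, a set $X$ of variables, their dotted versions $\dot X=\{\dot x\mid x\in X\}$ and step variables $\{y^+\mid y\in X\cup\dot X\}$, and a set $\Lambda$ of values. A valuation is a function $\sigma:X\cup\dot X\to\Lambda$; $\Sigma$ is the set of valuations, and $\sigma^+=\{(y^+,c)\mid (y,c)\in\sigma\}$. There are sets of predicates $P_g$ (guards), $P_t$ (initialization/time-can-progress/termination predicates, over $X\cup\dot X$), $P_r$ (reset predicates, over $X\cup\dot X$ and step variables), closed under conjunction, with a satisfaction relation $\sigma\models e$; for $e\in P_t$, $e^+$ denotes $e$ with each variable $y$ replaced by $y^+$, and $\mathrm{true}$ is the always-satisfied predicate. An atomic hierarchical hybrid automaton is $\alpha=(V,\mathrm{init},\mathrm{tcp},E,\mathrm{term},h)$ with $V\subseteq\mathcal{L}$, $\mathrm{init},\mathrm{tcp},\mathrm{term}:V\to P_t$, $E\subseteq V\times P_g\times\mathcal{A}\times P_r\times V$, and a partial function $h:V\rightharpoonup\mathcal{C}$.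 Compositions are given by the grammar $\mathcal{C}::=\alpha\mid \mathcal{C}:\alpha\mid \mathcal{C}\parallel_S\mathcal{C}$ with $S\subseteq\mathcal{A}$. For $v\in V$, $\alpha[v]$ denotes $\alpha$ with $\mathrm{init}$ replaced by the function mapping $w$ to the predicate $v=w$. Depth: $D(\alpha)=1+\max_{v\in\mathrm{dom}(h)}D(h(v))$ (with max over the empty set equal to $0$) and $D(q\parallel_S r)=\max(D(q),D(r))$; an automaton is flat if its depth is $1$, i.e. $\mathrm{dom}(h)=\emptyset$. Flattening. For $v\in\mathrm{dom}(h)$ write $h(v)=(V'_v,\mathrm{init}'_v,\mathrm{tcp}'_v,E'_v,\mathrm{term}'_v,\emptyset)$. Then $\hat V=\{(v,\bot)\mid v\in V\setminus\mathrm{dom}(h)\}\cup\{(v,w)\mid v\in\mathrm{dom}(h),w\in V'_v\}$ (pairs regarded as locations). For $\Box\in\{\mathrm{init},\mathrm{tcp},\mathrm{term}\}$: $\hat\Box((v,\bot))=\Box(v)$ and $\hat\Box((v,w))=\Box(v)\wedge\Box'_v(w)$ for $w\in V'_v$. With the convention $\mathrm{term}'(\bot)=\mathrm{true}$ and $\mathrm{init}'(\bot)=\mathrm{true}$, a tuple $(\hat v_0,g',a,r',\hat v_1)$ belongs to $\hat E$ iff either (1) $\hat v_0=(v_0,w_0),\hat v_1=(v_1,w_1)\in\hat V$, $(v_0,g,a,r,v_1)\in E$ for some $g,r$, $g'=\mathrm{term}'_{v_0}(w_0)\wedge g$ and $r'=r\wedge(\mathrm{init}'_{v_1}(w_1))^+$;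 or (2) $\hat v_0=(v,w_0)$, $\hat v_1=(v,w_1)$ with $v\in\mathrm{dom}(h)$, $w_0,w_1\in V'_v$ and $(w_0,g',a,r',w_1)\in E'_v$. Semantics: a transition system on states $\langle p,\sigma\rangle\in\mathcal{C}\times\Sigma$ with action transitions $\langle p,\sigma\rangle\xrightarrow{a}\langle p',\sigma'\rangle$, time transitions $\langle p,\sigma\rangle\overset{\rho,\theta,\omega}{\longmapsto}\langle p',\sigma'\rangle$ ($\rho:[0,t]\to\Sigma$, $\theta:[0,t]\to2^{\mathcal{A}}$, $\omega:[0,t]\to\mathbb{B}$), and environment transitions $\langle p,\sigma\rangle\overset{b}{\dashrightarrow}\langle p',\sigma'\rangle$ ($b\in\mathbb{B}$), the least relations closed under the rules below. Abbreviations: $\mathrm{edge}(v,g,a,r,v',\sigma,\sigma')$ means $(v,g,a,r,v')\in E\wedge\sigma\models\mathrm{init}(v)\wedge\sigma\models g\wedge\sigma'^+\cup\sigma\models r$; $\mathrm{flow}(v,\rho,t)$ means $\rho(0)\models\mathrm{init}(v)\wedge\mathrm{dom}(\rho)=[0,t]\wedge0\le t\wedge\forall s\in[0,t).\,\rho(s)\models\mathrm{tcp}(v)$. Atomic $\alpha$: (A1) if $\mathrm{edge}(v,g,a,r,v',\sigma,\sigma')$, ($\langle h(v),\sigma\rangle\overset{\mathrm{true}}{\dashrightarrow}\langle p,\sigma\rangle$ for some $p$, or $v\notin\mathrm{dom}(h)$), $v'\in\mathrm{dom}(h)$, $\langle h(v'),\sigma'\rangle\overset{b}{\dashrightarrow}\langle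 q,\sigma'\rangle$, then $\langle\alpha,\sigma\rangle\xrightarrow{a}\langle q:\alpha[v'],\sigma'\rangle$. (A2) if $\mathrm{edge}(v,g,a,r,v',\sigma,\sigma')$, $v'\notin\mathrm{dom}(h)$, ($\langle h(v),\sigma\rangle\overset{\mathrm{true}}{\dashrightarrow}\langle p,\sigma\rangle$ or $v\notin\mathrm{dom}(h)$), then $\langle\alpha,\sigma\rangle\xrightarrow{a}\langle\alpha[v'],\sigma'\rangle$. (A3) if $\sigma\models\mathrm{init}(v)$, $v\in\mathrm{dom}(h)$, $\langle h(v),\sigma\rangle\xrightarrow{a}\langle p,\sigma'\rangle$, then $\langle\alpha,\sigma\rangle\xrightarrow{a}\langle p:\alpha[v],\sigma'\rangle$. (A4) if $\mathrm{flow}(v,\rho,t)$ and $\langle h(v),\rho(0)\rangle\overset{\rho,\theta_0,\omega_0}{\longmapsto}\langle p,\rho(t)\rangle$, then $\langle\alpha,\rho(0)\rangle\overset{\rho,\theta,\omega}{\longmapsto}\langle p:\alpha[v],\rho(t)\rangle$ with $\omega(s)=\omega_0(s)\wedge\rho(s)\models\mathrm{term}(v)$, $\theta(s)=\theta_0(s)\cup\{a\mid(v,g,a,r,v')\in E\wedge\rho(s)\models g\wedge\omega_0(s)\}$. (A5) if $\mathrm{flow}(v,\rho,t)$, $v\notin\mathrm{dom}(h)$, then $\langle\alpha,\rho(0)\rangle\overset{\rho,\theta,\omega}{\longmapsto}\langle\alpha[v],\rho(t)\rangle$ with $\omega(s)=(\rho(s)\models\mathrm{term}(v))$, $\theta(s)=\{a\mid(v,g,a,r,v')\in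 E\wedge\rho(s)\models g\}$. (A6) if $\sigma\models\mathrm{init}(v)$ and $\langle h(v),\sigma\rangle\overset{b}{\dashrightarrow}\langle p,\sigma'\rangle$ then $\langle\alpha,\sigma\rangle\overset{(\sigma\models\mathrm{term}(v))\wedge b}{\dashrightarrow}\langle p:\alpha[v],\sigma'\rangle$. (A7) if $\sigma\models\mathrm{init}(v)$, $v\notin\mathrm{dom}(h)$, then $\langle\alpha,\sigma\rangle\overset{\sigma\models\mathrm{term}(v)}{\dashrightarrow}\langle\alpha[v],\sigma'\rangle$. Postfix $p:\alpha$: (P1) if $\mathrm{edge}(v,g,a,r,v',\sigma,\sigma')$, $\langle p,\sigma\rangle\overset{\mathrm{true}}{\dashrightarrow}\langle p',\sigma\rangle$, $\langle h(v'),\sigma'\rangle\overset{b}{\dashrightarrow}\langle q,\sigma'\rangle$, then $\langle p:\alpha,\sigma\rangle\xrightarrow{a}\langle q:\alpha[v'],\sigma'\rangle$. (P2) if $\mathrm{edge}(v,g,a,r,v',\sigma,\sigma')$, $\langle p,\sigma\rangle\overset{\mathrm{true}}{\dashrightarrow}\langle p',\sigma\rangle$, $v'\notin\mathrm{dom}(h)$, then $\langle p:\alpha,\sigma\rangle\xrightarrow{a}\langle\alpha[v'],\sigma'\rangle$. (P3) if $\langle p,\sigma\rangle\xrightarrow{a}\langle q,\sigma'\rangle$ then $\langle p:\alpha,\sigma\rangle\xrightarrow{a}\langle q:\alpha,\sigma'\rangle$. (P4) if $\mathrm{flow}(v,\rho,t)$ and $\langle p,\rho(0)\rangle\overset{\rho,\theta_0,\omega_0}{\longmapsto}\langle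 p',\rho(t)\rangle$ then $\langle p:\alpha,\rho(0)\rangle\overset{\rho,\theta,\omega}{\longmapsto}\langle p':\alpha[v],\rho(t)\rangle$ with $\omega(s)=\omega_0(s)\wedge\rho(s)\models\mathrm{term}(v)$, $\theta(s)=\theta_0(s)\cup\{a\mid(v,g,a,r,v)\in E\wedge\rho(s)\models g\wedge\omega_0(s)\}$. (P5) if $\langle p,\sigma\rangle\overset{b}{\dashrightarrow}\langle p',\sigma'\rangle$ then $\langle p:\alpha,\sigma\rangle\overset{(\sigma\models\mathrm{term}(v))\wedge b}{\dashrightarrow}\langle p':\alpha[v],\sigma'\rangle$ (for $v\in V$). Parallel (each rule also yields the symmetric conclusion for $q\parallel_S p$): (S1) synchronous $a\in S$ steps of both $p$ and $q$ with the same $\sigma,\sigma'$ give $\langle p\parallel_S q,\sigma\rangle\xrightarrow{a}\langle p'\parallel_S q',\sigma'\rangle$; (S2) if $\langle p,\sigma\rangle\xrightarrow{a}\langle p',\sigma'\rangle$, $\langle q,\sigma\rangle\overset{b}{\dashrightarrow}\langle q',\sigma'\rangle$, $a\notin S$, then $\langle p\parallel_S q,\sigma\rangle\xrightarrow{a}\langle p'\parallel_S q',\sigma'\rangle$; (S3) time steps of $p$ and $q$ with the same $\rho$ and trajectories $(\theta_0,\omega_0)$, $(\theta_1,\omega_1)$ give a time step of $p\parallel_S q$ to $p'\parallel_S q'$ with $\theta(s)=(\theta_0(s)\cap\theta_1(s))\cup(\theta_0(s)\setminus S)\cup(\theta_1(s)\setminus S)$, $\omega(s)=\omega_0(s)\wedge\omega_1(s)$;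 (S4) environment steps with $b_0,b_1$ and the same $\sigma,\sigma'$ give $\langle p\parallel_S q,\sigma\rangle\overset{b_0\wedge b_1}{\dashrightarrow}\langle p'\parallel_S q',\sigma'\rangle$. A symmetric relation $R\subseteq\mathcal{C}\times\mathcal{C}$ is a stateless bisimulation if whenever $(p,q)\in R$, each action, time, or environment transition from $\langle p,\sigma\rangle$ to $\langle p',\sigma'\rangle$ is matched by a transition of the same kind with identical label from $\langle q,\sigma\rangle$ to some $\langle q',\sigma'\rangle$ with $(p',q')\in R$. $p\cong q$ iff some stateless bisimulation contains $(p,q)$.
   Formalization: In (P4) the enabled actions range over edges (v,g,a,r,v') to any target v', not only self-loops; (P5) additionally requires σ ⊨ init(v); every automaton is assumed to have a nonempty set V of locations. As printed, each of these points makes the claim false. *)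

theory Defs
  imports Complex_Main "HOL-Library.Extended_Nat"
begin

text \<open>
  The type parameters are \<open>'l\<close> (locations), \<open>'a\<close> (actions), \<open>'x\<close> (variables), \<open>'v\<close> (values) and
  \<open>'e\<close> (predicates).
\<close>

datatype 'x dvar = Plain 'x | Dotted 'x

type_synonym ('x, 'v) valuation = "'x dvar \<Rightarrow> 'v"

text \<open>
  Predicates are interpreted in sets of pairs (variable, value), i.e. partial maps on ordinary and
  step variables: \<open>cur \<sigma>\<close> is the valuation \<open>\<sigma>\<close> itself and \<open>stp \<sigma>\<close> is its step version
  \<open>\<sigma>\<^sup>+\<close>, so that \<open>\<sigma>'\<^sup>+ \<union> \<sigma>\<close> is \<open>stp \<sigma>' ++ cur \<sigma>\<close> (a union of maps with disjoint domains).
\<close>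

datatype 'x svar = Cur "'x dvar" | Step "'x dvar"

definition cur :: "('x, 'v) valuation \<Rightarrow> 'x svar \<rightharpoonup> 'v" where
  "cur \<sigma> = (\<lambda>z. case z of Cur y \<Rightarrow> Some (\<sigma> y) | Step y \<Rightarrow> None)"

definition stp :: "('x, 'v) valuation \<Rightarrow> 'x svar \<rightharpoonup> 'v" where
  "stp \<sigma> = (\<lambda>z. case z of Cur y \<Rightarrow> None | Step y \<Rightarrow> Some (\<sigma> y))"

text \<open>
  A predicate language: the three sets of predicates, satisfaction, and the predicate formers
  conjunction, \<open>true\<close>, \<open>e\<^sup>+\<close> and the location equality \<open>v = w\<close>.
\<close>

record ('l, 'x, 'v, 'e) pred_lang =
  Pg :: "'e set"
  Pt :: "'e set"
  Pr :: "'e set"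
  sat :: "('x svar \<rightharpoonup> 'v) \<Rightarrow> 'e \<Rightarrow> bool"
  conjp :: "'e \<Rightarrow> 'e \<Rightarrow> 'e"
  truep :: 'e
  stepp :: "'e \<Rightarrow> 'e"
  eqp :: "'l \<Rightarrow> 'l \<Rightarrow> 'e"

text \<open>
  Flattening conjoins a guard with a termination predicate and a reset with a step version of an
  initialization predicate; closure under conjunction includes these two mixed cases.
\<close>

definition predicate_language :: "('l, 'x, 'v, 'e) pred_lang \<Rightarrow> bool" where
  "predicate_language L \<longleftrightarrow>
     (\<forall>e\<in>Pg L. \<forall>f\<in>Pg L. conjp L e f \<in> Pg L) \<and>
     (\<forall>e\<in>Pt L. \<forall>f\<in>Pt L. conjp L e f \<in> Pt L) \<and>
     (\<forall>e\<in>Pr L. \<forall>f\<in>Pr L. conjp L e f \<in> Pr L) \<and>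
     (\<forall>e\<in>Pt L. \<forall>g\<in>Pg L. conjp L e g \<in> Pg L) \<and>
     (\<forall>r\<in>Pr L. \<forall>e\<in>Pt L. conjp L r (stepp L e) \<in> Pr L) \<and>
     truep L \<in> Pt L \<and>
     (\<forall>v w. eqp L v w \<in> Pt L) \<and>
     (\<forall>m e f. sat L m (conjp L e f) \<longleftrightarrow> sat L m e \<and> sat L m f) \<and>
     (\<forall>m. sat L m (truep L)) \<and>
     (\<forall>m v w. sat L m (eqp L v w) \<longleftrightarrow> v = w) \<and>
     (\<forall>\<sigma> \<sigma>'. \<forall>e\<in>Pt L. sat L (stp \<sigma>' ++ cur \<sigma>) (stepp L e) \<longleftrightarrow> sat L (cur \<sigma>') e)"

text \<open>
  The datatype contains raw tuples, whose components are total functions on the type of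
  locations; membership in the sets of well-formed automata and compositions is expressed by
  \<open>wf_automaton\<close> and \<open>wf_comp\<close> below.
\<close>

datatype ('l, 'a, 'e) automaton =
    Automaton
      (locs: "'l set")
      (init: "'l \<Rightarrow> 'e")
      (tcp: "'l \<Rightarrow> 'e")
      (edges: "('l \<times> 'e \<times> 'a \<times> 'e \<times> 'l) set")
      (trm: "'l \<Rightarrow> 'e")
      (sub: "'l \<rightharpoonup> ('l, 'a, 'e) comp")
and ('l, 'a, 'e) comp =
    Atom (the_automaton: "('l, 'a, 'e) automaton")
  | Postfix "('l, 'a, 'e) comp" "('l, 'a, 'e) automaton"
  | Par "('l, 'a, 'e) comp" "'a set" "('l, 'a, 'e) comp"

text \<open>
  Automata have at least one location. An automaton without locations can never be entered, yet an
  edge into a location with such a substructure would contribute its action to the enabled-action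
  trajectory of a time transition, whereas flattening has no location to serve as target of that
  edge.
\<close>

inductive wf_automaton :: "('l, 'x, 'v, 'e) pred_lang \<Rightarrow> ('l, 'a, 'e) automaton \<Rightarrow> bool"
  and wf_comp :: "('l, 'x, 'v, 'e) pred_lang \<Rightarrow> ('l, 'a, 'e) comp \<Rightarrow> bool"
  for L :: "('l, 'x, 'v, 'e) pred_lang"
where
  "\<lbrakk> locs \<alpha> \<noteq> {};
     init \<alpha> ` locs \<alpha> \<subseteq> Pt L; tcp \<alpha> ` locs \<alpha> \<subseteq> Pt L; trm \<alpha> ` locs \<alpha> \<subseteq> Pt L;
     edges \<alpha> \<subseteq> locs \<alpha> \<times> Pg L \<times> UNIV \<times> Pr L \<times> locs \<alpha>;
     dom (sub \<alpha>) \<subseteq> locs \<alpha>;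
     \<And>v q. sub \<alpha> v = Some q \<Longrightarrow> wf_comp L q \<rbrakk> \<Longrightarrow> wf_automaton L \<alpha>"
| "wf_automaton L \<alpha> \<Longrightarrow> wf_comp L (Atom \<alpha>)"
| "\<lbrakk> wf_comp L p; wf_automaton L \<alpha> \<rbrakk> \<Longrightarrow> wf_comp L (Postfix p \<alpha>)"
| "\<lbrakk> wf_comp L p; wf_comp L q \<rbrakk> \<Longrightarrow> wf_comp L (Par p S q)"

text \<open>
  The depth is extended so that the supremum over an infinite \<open>dom h\<close> exists. In \<open>p : \<alpha>\<close> the
  composition \<open>p\<close> runs inside a location of \<open>\<alpha>\<close>, which determines the clause for \<open>Postfix\<close>.
\<close>

primrec depth_automaton :: "('l, 'a, 'e) automaton \<Rightarrow> enat"
  and depth :: "('l, 'a, 'e) comp \<Rightarrow> enat" where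
  "depth_automaton (Automaton V ini tc E tm h) =
     1 + Sup (\<Union>v. set_option ((map_option depth \<circ> h) v))"
| "depth (Atom \<alpha>) = depth_automaton \<alpha>"
| "depth (Postfix p \<alpha>) = max (1 + depth p) (depth_automaton \<alpha>)"
| "depth (Par p S q) = max (depth p) (depth q)"

definition flat :: "('l, 'a, 'e) automaton \<Rightarrow> bool" where
  "flat \<alpha> \<longleftrightarrow> depth (Atom \<alpha>) = 1"

lemma depth_Atom: "depth (Atom \<alpha>) = 1 + (SUP q\<in>ran (sub \<alpha>). depth q)"
proof (cases \<alpha>)
  case (Automaton V ini tc E tm h)
  have "(\<Union>v. set_option ((map_option depth \<circ> h) v)) = depth ` ran h"
    by (auto simp: ran_def image_iff)
  then show ?thesis by (simp add: Automaton)
qed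

lemma depth_ge_1: "1 \<le> depth p"
proof (induction p rule: comp.induct[where ?P1.0 = "\<lambda>_. True"])
  case (Atom \<alpha>)
  show ?case by (simp only: depth_Atom) simp
qed (auto simp: le_max_iff_disj)

lemma flat_iff: "flat \<alpha> \<longleftrightarrow> dom (sub \<alpha>) = {}"
proof
  assume "flat \<alpha>"
  then have "1 + (SUP q\<in>ran (sub \<alpha>). depth q) = 1"
    by (simp only: flat_def depth_Atom)
  then have *: "(SUP q\<in>ran (sub \<alpha>). depth q) = 0"
    by (cases "SUP q\<in>ran (sub \<alpha>). depth q") (auto simp: one_enat_def zero_enat_def)
  have "False" if "q \<in> ran (sub \<alpha>)" for q
  proof -
    have "depth q \<le> 0" using that SUP_upper[of q "ran (sub \<alpha>)" depth] * by simp
    then show False using depth_ge_1[of q] by simp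
  qed
  then show "dom (sub \<alpha>) = {}" by (metis domIff equals0I not_None_eq ranI)
next
  assume "dom (sub \<alpha>) = {}"
  then have "ran (sub \<alpha>) = {}" by (auto simp: ran_def)
  then show "flat \<alpha>" by (simp only: flat_def depth_Atom) (simp add: bot_enat_def)
qed

text \<open>\<open>at_loc L \<alpha> v\<close> is \<open>\<alpha>[v]\<close>.\<close>

definition at_loc :: "('l, 'x, 'v, 'e) pred_lang \<Rightarrow> ('l, 'a, 'e) automaton \<Rightarrow> 'l \<Rightarrow> ('l, 'a, 'e) automaton" where
  "at_loc L \<alpha> v =
     Automaton (locs \<alpha>) (\<lambda>w. eqp L v w) (tcp \<alpha>) (edges \<alpha>) (trm \<alpha>) (sub \<alpha>)"

definition edge :: "('l, 'x, 'v, 'e) pred_lang \<Rightarrow> ('l, 'a, 'e) automaton \<Rightarrow> 'l \<Rightarrow> 'e \<Rightarrow> 'a \<Rightarrow> 'e \<Rightarrow> 'l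
    \<Rightarrow> ('x, 'v) valuation \<Rightarrow> ('x, 'v) valuation \<Rightarrow> bool" where
  "edge L \<alpha> v g a r v' \<sigma> \<sigma>' \<longleftrightarrow>
     (v, g, a, r, v') \<in> edges \<alpha> \<and> sat L (cur \<sigma>) (init \<alpha> v) \<and> sat L (cur \<sigma>) g \<and>
     sat L (stp \<sigma>' ++ cur \<sigma>) r"

text \<open>Functions on \<open>[0,t]\<close> are partial maps on the reals with domain \<open>{0..t}\<close>.\<close>

definition on :: "real set \<Rightarrow> (real \<Rightarrow> 'b) \<Rightarrow> real \<rightharpoonup> 'b" where
  "on A f = (\<lambda>s. if s \<in> A then Some (f s) else None)"

definition flow :: "('l, 'x, 'v, 'e) pred_lang \<Rightarrow> ('l, 'a, 'e) automaton \<Rightarrow> 'l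
    \<Rightarrow> (real \<rightharpoonup> ('x, 'v) valuation) \<Rightarrow> real \<Rightarrow> bool" where
  "flow L \<alpha> v \<rho> t \<longleftrightarrow>
     v \<in> locs \<alpha> \<and> 0 \<le> t \<and> dom \<rho> = {0..t} \<and> sat L (cur (the (\<rho> 0))) (init \<alpha> v) \<and>
     (\<forall>s\<in>{0..<t}. sat L (cur (the (\<rho> s))) (tcp \<alpha> v))"

text \<open>\<open>env L p \<sigma> b p' \<sigma>'\<close> is the environment transition from \<open>\<langle>p, \<sigma>\<rangle>\<close> to \<open>\<langle>p', \<sigma>'\<rangle>\<close>
  labelled \<open>b\<close>; similarly for the two other kinds of transitions. In the rule for \<open>p : \<alpha>\<close>, as in
  the rules for atomic automata, \<open>v\<close> is the current location of \<open>\<alpha>\<close>, i.e. \<open>\<sigma> \<Turnstile> init(v)\<close>.\<close>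

inductive env :: "('l, 'x, 'v, 'e) pred_lang \<Rightarrow> ('l, 'a, 'e) comp \<Rightarrow> ('x, 'v) valuation \<Rightarrow> bool
    \<Rightarrow> ('l, 'a, 'e) comp \<Rightarrow> ('x, 'v) valuation \<Rightarrow> bool"
  for L :: "('l, 'x, 'v, 'e) pred_lang"
where
  Atom_sub:
    "\<lbrakk> v \<in> locs \<alpha>; sat L (cur \<sigma>) (init \<alpha> v); sub \<alpha> v = Some q; env L q \<sigma> b p \<sigma>' \<rbrakk>
     \<Longrightarrow> env L (Atom \<alpha>) \<sigma> (sat L (cur \<sigma>) (trm \<alpha> v) \<and> b) (Postfix p (at_loc L \<alpha> v)) \<sigma>'"
| Atom_nosub:
    "\<lbrakk> v \<in> locs \<alpha>; sat L (cur \<sigma>) (init \<alpha> v); sub \<alpha> v = None \<rbrakk>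
     \<Longrightarrow> env L (Atom \<alpha>) \<sigma> (sat L (cur \<sigma>) (trm \<alpha> v)) (Atom (at_loc L \<alpha> v)) \<sigma>'"
| Postfix:
    "\<lbrakk> v \<in> locs \<alpha>; sat L (cur \<sigma>) (init \<alpha> v); env L p \<sigma> b p' \<sigma>' \<rbrakk>
     \<Longrightarrow> env L (Postfix p \<alpha>) \<sigma> (sat L (cur \<sigma>) (trm \<alpha> v) \<and> b) (Postfix p' (at_loc L \<alpha> v)) \<sigma>'"
| Par:
    "\<lbrakk> env L p \<sigma> b0 p' \<sigma>'; env L q \<sigma> b1 q' \<sigma>' \<rbrakk>
     \<Longrightarrow> env L (Par p S q) \<sigma> (b0 \<and> b1) (Par p' S q') \<sigma>'"

text \<open>The symmetric variants of all rules for parallel composition other than the interleaving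
  rule are instances of the rules themselves.\<close>

inductive act :: "('l, 'x, 'v, 'e) pred_lang \<Rightarrow> ('l, 'a, 'e) comp \<Rightarrow> ('x, 'v) valuation \<Rightarrow> 'a
    \<Rightarrow> ('l, 'a, 'e) comp \<Rightarrow> ('x, 'v) valuation \<Rightarrow> bool"
  for L :: "('l, 'x, 'v, 'e) pred_lang"
where
  Atom_to_sub:
    "\<lbrakk> edge L \<alpha> v g a r v' \<sigma> \<sigma>';
       (\<exists>h p. sub \<alpha> v = Some h \<and> env L h \<sigma> True p \<sigma>) \<or> sub \<alpha> v = None;
       sub \<alpha> v' = Some h'; env L h' \<sigma>' b q \<sigma>' \<rbrakk>
     \<Longrightarrow> act L (Atom \<alpha>) \<sigma> a (Postfix q (at_loc L \<alpha> v')) \<sigma>'"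
| Atom_to_nosub:
    "\<lbrakk> edge L \<alpha> v g a r v' \<sigma> \<sigma>'; sub \<alpha> v' = None;
       (\<exists>h p. sub \<alpha> v = Some h \<and> env L h \<sigma> True p \<sigma>) \<or> sub \<alpha> v = None \<rbrakk>
     \<Longrightarrow> act L (Atom \<alpha>) \<sigma> a (Atom (at_loc L \<alpha> v')) \<sigma>'"
| Atom_inner:
    "\<lbrakk> v \<in> locs \<alpha>; sat L (cur \<sigma>) (init \<alpha> v); sub \<alpha> v = Some h; act L h \<sigma> a p \<sigma>' \<rbrakk>
     \<Longrightarrow> act L (Atom \<alpha>) \<sigma> a (Postfix p (at_loc L \<alpha> v)) \<sigma>'"
| Postfix_to_sub:
    "\<lbrakk> edge L \<alpha> v g a r v' \<sigma> \<sigma>'; env L p \<sigma> True p' \<sigma>;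
       sub \<alpha> v' = Some h'; env L h' \<sigma>' b q \<sigma>' \<rbrakk>
     \<Longrightarrow> act L (Postfix p \<alpha>) \<sigma> a (Postfix q (at_loc L \<alpha> v')) \<sigma>'"
| Postfix_to_nosub:
    "\<lbrakk> edge L \<alpha> v g a r v' \<sigma> \<sigma>'; env L p \<sigma> True p' \<sigma>; sub \<alpha> v' = None \<rbrakk>
     \<Longrightarrow> act L (Postfix p \<alpha>) \<sigma> a (Atom (at_loc L \<alpha> v')) \<sigma>'"
| Postfix_inner:
    "act L p \<sigma> a q \<sigma>' \<Longrightarrow> act L (Postfix p \<alpha>) \<sigma> a (Postfix q \<alpha>) \<sigma>'"
| Par_sync:
    "\<lbrakk> a \<in> S; act L p \<sigma> a p' \<sigma>'; act L q \<sigma> a q' \<sigma>' \<rbrakk>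
     \<Longrightarrow> act L (Par p S q) \<sigma> a (Par p' S q') \<sigma>'"
| Par_left:
    "\<lbrakk> a \<notin> S; act L p \<sigma> a p' \<sigma>'; env L q \<sigma> b q' \<sigma>' \<rbrakk>
     \<Longrightarrow> act L (Par p S q) \<sigma> a (Par p' S q') \<sigma>'"
| Par_right:
    "\<lbrakk> a \<notin> S; act L p \<sigma> a p' \<sigma>'; env L q \<sigma> b q' \<sigma>' \<rbrakk>
     \<Longrightarrow> act L (Par q S p) \<sigma> a (Par q' S p') \<sigma>'"

text \<open>Actions of the outgoing edges of \<open>v\<close>, to any target, whose guard holds in \<open>\<sigma>\<close>.\<close>

definition enabled :: "('l, 'x, 'v, 'e) pred_lang \<Rightarrow> ('l, 'a, 'e) automaton \<Rightarrow> 'l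
    \<Rightarrow> ('x, 'v) valuation \<Rightarrow> 'a set" where
  "enabled L \<alpha> v \<sigma> = {a. \<exists>g r v'. (v, g, a, r, v') \<in> edges \<alpha> \<and> sat L (cur \<sigma>) g}"

inductive time :: "('l, 'x, 'v, 'e) pred_lang \<Rightarrow> ('l, 'a, 'e) comp \<Rightarrow> ('x, 'v) valuation
    \<Rightarrow> (real \<rightharpoonup> ('x, 'v) valuation) \<Rightarrow> (real \<rightharpoonup> 'a set) \<Rightarrow> (real \<rightharpoonup> bool)
    \<Rightarrow> ('l, 'a, 'e) comp \<Rightarrow> ('x, 'v) valuation \<Rightarrow> bool"
  for L :: "('l, 'x, 'v, 'e) pred_lang"
where
  Atom_sub:
    "\<lbrakk> flow L \<alpha> v \<rho> t; sub \<alpha> v = Some h; time L h (the (\<rho> 0)) \<rho> \<theta>0 \<omega>0 p (the (\<rho> t));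
       \<omega> = on {0..t} (\<lambda>s. the (\<omega>0 s) \<and> sat L (cur (the (\<rho> s))) (trm \<alpha> v));
       \<theta> = on {0..t} (\<lambda>s. the (\<theta>0 s) \<union> {a \<in> enabled L \<alpha> v (the (\<rho> s)). the (\<omega>0 s)}) \<rbrakk>
     \<Longrightarrow> time L (Atom \<alpha>) (the (\<rho> 0)) \<rho> \<theta> \<omega> (Postfix p (at_loc L \<alpha> v)) (the (\<rho> t))"
| Atom_nosub:
    "\<lbrakk> flow L \<alpha> v \<rho> t; sub \<alpha> v = None;
       \<omega> = on {0..t} (\<lambda>s. sat L (cur (the (\<rho> s))) (trm \<alpha> v));
       \<theta> = on {0..t} (\<lambda>s. enabled L \<alpha> v (the (\<rho> s))) \<rbrakk>
     \<Longrightarrow> time L (Atom \<alpha>) (the (\<rho> 0)) \<rho> \<theta> \<omega> (Atom (at_loc L \<alpha> v)) (the (\<rho> t))"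
| Postfix:
    "\<lbrakk> flow L \<alpha> v \<rho> t; time L p (the (\<rho> 0)) \<rho> \<theta>0 \<omega>0 p' (the (\<rho> t));
       \<omega> = on {0..t} (\<lambda>s. the (\<omega>0 s) \<and> sat L (cur (the (\<rho> s))) (trm \<alpha> v));
       \<theta> = on {0..t} (\<lambda>s. the (\<theta>0 s) \<union> {a \<in> enabled L \<alpha> v (the (\<rho> s)). the (\<omega>0 s)}) \<rbrakk>
     \<Longrightarrow> time L (Postfix p \<alpha>) (the (\<rho> 0)) \<rho> \<theta> \<omega> (Postfix p' (at_loc L \<alpha> v)) (the (\<rho> t))"
| Par:
    "\<lbrakk> time L p \<sigma> \<rho> \<theta>0 \<omega>0 p' \<sigma>'; time L q \<sigma> \<rho> \<theta>1 \<omega>1 q' \<sigma>';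
       \<omega> = on (dom \<rho>) (\<lambda>s. the (\<omega>0 s) \<and> the (\<omega>1 s));
       \<theta> = on (dom \<rho>) (\<lambda>s. (the (\<theta>0 s) \<inter> the (\<theta>1 s)) \<union> (the (\<theta>0 s) - S) \<union> (the (\<theta>1 s) - S)) \<rbrakk>
     \<Longrightarrow> time L (Par p S q) \<sigma> \<rho> \<theta> \<omega> (Par p' S q') \<sigma>'"

definition stateless_bisimulation ::
    "('l, 'x, 'v, 'e) pred_lang \<Rightarrow> (('l, 'a, 'e) comp \<times> ('l, 'a, 'e) comp) set \<Rightarrow> bool" where
  "stateless_bisimulation L R \<longleftrightarrow>
     R \<subseteq> {p. wf_comp L p} \<times> {p. wf_comp L p} \<and> sym R \<and>
     (\<forall>(p, q)\<in>R. \<forall>\<sigma> p' \<sigma>'.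
        (\<forall>a. act L p \<sigma> a p' \<sigma>' \<longrightarrow> (\<exists>q'. act L q \<sigma> a q' \<sigma>' \<and> (p', q') \<in> R)) \<and>
        (\<forall>\<rho> \<theta> \<omega>. time L p \<sigma> \<rho> \<theta> \<omega> p' \<sigma>' \<longrightarrow> (\<exists>q'. time L q \<sigma> \<rho> \<theta> \<omega> q' \<sigma>' \<and> (p', q') \<in> R)) \<and>
        (\<forall>b. env L p \<sigma> b p' \<sigma>' \<longrightarrow> (\<exists>q'. env L q \<sigma> b q' \<sigma>' \<and> (p', q') \<in> R)))"

definition stateless_bisimilar ::
    "('l, 'x, 'v, 'e) pred_lang \<Rightarrow> ('l, 'a, 'e) comp \<Rightarrow> ('l, 'a, 'e) comp \<Rightarrow> bool" where
  "stateless_bisimilar L p q \<longleftrightarrow> (\<exists>R. stateless_bisimulation L R \<and> (p, q) \<in> R)"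

text \<open>
  Flattening. The locations of the flat automaton are pairs \<open>(v, None)\<close> (for \<open>(v, \<bottom>)\<close>) and
  \<open>(v, Some w)\<close>, regarded as locations by means of an injection \<open>enc_pair\<close>.
\<close>

definition sub_aut :: "('l, 'a, 'e) automaton \<Rightarrow> 'l \<Rightarrow> ('l, 'a, 'e) automaton" where
  "sub_aut \<alpha> v = the_automaton (the (sub \<alpha> v))"

definition flat_locs :: "('l, 'a, 'e) automaton \<Rightarrow> ('l \<times> 'l option) set" where
  "flat_locs \<alpha> =
     {(v, None) | v. v \<in> locs \<alpha> - dom (sub \<alpha>)} \<union>
     {(v, Some w) | v w. v \<in> dom (sub \<alpha>) \<and> w \<in> locs (sub_aut \<alpha> v)}"

definition flat_pred :: "('l, 'x, 'v, 'e) pred_lang \<Rightarrow> (('l, 'a, 'e) automaton \<Rightarrow> 'l \<Rightarrow> 'e)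
    \<Rightarrow> ('l, 'a, 'e) automaton \<Rightarrow> 'l \<times> 'l option \<Rightarrow> 'e" where
  "flat_pred L f \<alpha> = (\<lambda>(v, x). case x of
       None \<Rightarrow> f \<alpha> v
     | Some w \<Rightarrow> conjp L (f \<alpha> v) (f (sub_aut \<alpha> v) w))"

definition inner_pred :: "('l, 'x, 'v, 'e) pred_lang \<Rightarrow> (('l, 'a, 'e) automaton \<Rightarrow> 'l \<Rightarrow> 'e)
    \<Rightarrow> ('l, 'a, 'e) automaton \<Rightarrow> 'l \<times> 'l option \<Rightarrow> 'e" where
  "inner_pred L f \<alpha> = (\<lambda>(v, x). case x of
       None \<Rightarrow> truep L
     | Some w \<Rightarrow> f (sub_aut \<alpha> v) w)"

definition flat_edges :: "('l, 'x, 'v, 'e) pred_lang \<Rightarrow> ('l, 'a, 'e) automaton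
    \<Rightarrow> (('l \<times> 'l option) \<times> 'e \<times> 'a \<times> 'e \<times> ('l \<times> 'l option)) set" where
  "flat_edges L \<alpha> =
     {((v0, x0), conjp L (inner_pred L trm \<alpha> (v0, x0)) g, a,
         conjp L r (stepp L (inner_pred L init \<alpha> (v1, x1))), (v1, x1)) | v0 x0 g a r v1 x1.
       (v0, x0) \<in> flat_locs \<alpha> \<and> (v1, x1) \<in> flat_locs \<alpha> \<and> (v0, g, a, r, v1) \<in> edges \<alpha>} \<union>
     {((v, Some w0), g', a, r', (v, Some w1)) | v w0 g' a r' w1.
       v \<in> dom (sub \<alpha>) \<and> w0 \<in> locs (sub_aut \<alpha> v) \<and> w1 \<in> locs (sub_aut \<alpha> v) \<and>
       (w0, g', a, r', w1) \<in> edges (sub_aut \<alpha> v)}"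

definition enc :: "('l, 'x, 'v, 'e) pred_lang \<Rightarrow> ('l \<times> 'l option \<Rightarrow> 'l) \<Rightarrow> ('l, 'a, 'e) automaton
    \<Rightarrow> ('l, 'a, 'e) automaton" where
  "enc L enc_pair \<alpha> =
     Automaton
       (enc_pair ` flat_locs \<alpha>)
       (\<lambda>l. flat_pred L init \<alpha> (inv enc_pair l))
       (\<lambda>l. flat_pred L tcp \<alpha> (inv enc_pair l))
       ((\<lambda>(x0, g, a, r, x1). (enc_pair x0, g, a, r, enc_pair x1)) ` flat_edges L \<alpha>)
       (\<lambda>l. flat_pred L trm \<alpha> (inv enc_pair l))
       Map.empty"

end

theory Submission
  imports Defs
begin

text \<open>
  A reachable state of \<open>\<alpha>\<close> is either \<open>\<alpha>\<close> itself or is determined by a location \<open>x\<close> of the flat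
  automaton: \<open>\<alpha>[v]\<close> for \<open>x = (v, \<bottom>)\<close> and \<open>h(v)[w] : \<alpha>[v]\<close> for \<open>x = (v, w)\<close>. All transitions
  of such a state can be expressed through the flat data and the set of flat locations in which
  it may currently be. The states of \<open>enc(\<alpha>)\<close> satisfy the same description, so two states that
  may be in the same flat locations have the same transitions, to targets with the same location.
\<close>

text \<open>The obstacle is nondeterminism: at a given valuation \<open>\<alpha>\<close> may be in
  several locations \<open>v\<close>, and \<open>h(v)\<close> in several locations \<open>w\<close>,
  and each transition resolves both choices at once. The set of possible flat locations therefore
  depends on the valuation for \<open>\<alpha>\<close> itself, and is a singleton after every
  transition. Leaving a substructure requires inner termination before the step, which becomes the
  extra conjunct of a flat guard; entering one requires inner initialization after the step, which
  becomes the extra conjunct of a flat reset. The enabled actions recorded along a time step ignore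
  resets and the initialization of the target, so each edge target needs at least one flat location
  above it; this is where nonempty location sets matter. The whole description lives on pairs
  \<open>(v, x)\<close>; the injection into locations enters only on the side of
  \<open>enc\<close>.\<close>

lemma at_loc_simps [simp]:
  "locs (at_loc L \<alpha> v) = locs \<alpha>" "init (at_loc L \<alpha> v) = eqp L v"
  "tcp (at_loc L \<alpha> v) = tcp \<alpha>" "edges (at_loc L \<alpha> v) = edges \<alpha>"
  "trm (at_loc L \<alpha> v) = trm \<alpha>" "sub (at_loc L \<alpha> v) = sub \<alpha>"
  "at_loc L (at_loc L \<alpha> v) w = at_loc L \<alpha> w"
  by (simp_all add: at_loc_def)

lemma enabled_at_loc [simp]: "enabled L (at_loc L \<alpha> u) = enabled L \<alpha>"
  by (intro ext) (simp add: enabled_def)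

lemma wf_automaton_at_loc:
  assumes "predicate_language L" "wf_automaton L \<alpha>"
  shows "wf_automaton L (at_loc L \<alpha> v)"
  using assms(2,1)
  by (cases rule: wf_automaton.cases)
    (rule wf_automaton_wf_comp.intros(1); auto simp: predicate_language_def)

section \<open>Transitions of flat automata\<close>

lemma env_Atom_flat:
  assumes "sub \<beta> = Map.empty"
  shows "env L (Atom \<beta>) \<sigma> b p \<sigma>' \<longleftrightarrow>
    (\<exists>v\<in>locs \<beta>. sat L (cur \<sigma>) (init \<beta> v) \<and> b = sat L (cur \<sigma>) (trm \<beta> v) \<and> p = Atom (at_loc L \<beta> v))"
  using assms by (subst env.simps) auto

lemma act_Atom_flat:
  assumes "sub \<beta> = Map.empty"
  shows "act L (Atom \<beta>) \<sigma> a p \<sigma>' \<longleftrightarrow>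
    (\<exists>v g r v'. edge L \<beta> v g a r v' \<sigma> \<sigma>' \<and> p = Atom (at_loc L \<beta> v'))"
  using assms by (subst act.simps) auto

lemma time_Atom_flat:
  assumes "sub \<beta> = Map.empty"
  shows "time L (Atom \<beta>) \<sigma> \<rho> \<theta> \<omega> p \<sigma>' \<longleftrightarrow>
    (\<exists>v t. flow L \<beta> v \<rho> t \<and> \<sigma> = the (\<rho> 0) \<and> \<sigma>' = the (\<rho> t) \<and>
       \<omega> = on {0..t} (\<lambda>s. sat L (cur (the (\<rho> s))) (trm \<beta> v)) \<and>
       \<theta> = on {0..t} (\<lambda>s. enabled L \<beta> v (the (\<rho> s))) \<and> p = Atom (at_loc L \<beta> v))"
  using assms by (subst time.simps) auto

section \<open>Transitions in terms of the flat data\<close>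

definition flat_enabled where
  "flat_enabled L \<alpha> x \<sigma> = {a. \<exists>g r x'. (x, g, a, r, x') \<in> flat_edges L \<alpha> \<and> sat L (cur \<sigma>) g}"

lemma flat_enabledI:
  "(x, g, a, r, x') \<in> flat_edges L \<alpha> \<Longrightarrow> sat L (cur \<sigma>) g \<Longrightarrow> a \<in> flat_enabled L \<alpha> x \<sigma>"
  unfolding flat_enabled_def by blast

definition flat_step where
  "flat_step L \<alpha> x a x' \<sigma> \<sigma>' \<longleftrightarrow> (\<exists>g r. (x, g, a, r, x') \<in> flat_edges L \<alpha> \<and>
     sat L (cur \<sigma>) g \<and> sat L (stp \<sigma>' ++ cur \<sigma>) r)"

lemma flat_stepI:
  "(x, g, a, r, x') \<in> flat_edges L \<alpha> \<Longrightarrow> sat L (cur \<sigma>) g \<Longrightarrow> sat L (stp \<sigma>' ++ cur \<sigma>) r \<Longrightarrow>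
   flat_step L \<alpha> x a x' \<sigma> \<sigma>'"
  unfolding flat_step_def by blast

text \<open>The initial condition is a parameter, so that one notion serves both
  \<open>\<alpha>\<close>, where it is satisfaction of the flat initialization predicate, and a
  configuration, where it is equality with a fixed location.\<close>

definition flat_flow where
  "flat_flow L \<alpha> I x \<rho> t \<longleftrightarrow> x \<in> flat_locs \<alpha> \<and> (0::real) \<le> t \<and> dom \<rho> = {0..t} \<and> I (the (\<rho> 0)) x \<and>
     (\<forall>s\<in>{0..<t}. sat L (cur (the (\<rho> s))) (flat_pred L tcp \<alpha> x))"

text \<open>
  \<open>I \<sigma>\<close> is the set of flat locations in which \<open>p\<close> may be at \<open>\<sigma>\<close>, and \<open>c x\<close> is the composition
  reached by a transition ending in \<open>x\<close>.
\<close>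

definition presents where
  "presents L \<alpha> I c p \<longleftrightarrow>
     (\<forall>\<sigma> b p' \<sigma>'. env L p \<sigma> b p' \<sigma>' \<longleftrightarrow>
        (\<exists>x\<in>flat_locs \<alpha>. I \<sigma> x \<and> b = sat L (cur \<sigma>) (flat_pred L trm \<alpha> x) \<and> p' = c x)) \<and>
     (\<forall>\<sigma> a p' \<sigma>'. act L p \<sigma> a p' \<sigma>' \<longleftrightarrow>
        (\<exists>x x'. I \<sigma> x \<and> flat_step L \<alpha> x a x' \<sigma> \<sigma>' \<and> p' = c x')) \<and>
     (\<forall>\<sigma> \<rho> \<theta> \<omega> p' \<sigma>'. time L p \<sigma> \<rho> \<theta> \<omega> p' \<sigma>' \<longleftrightarrow>
        (\<exists>x t. flat_flow L \<alpha> I x \<rho> t \<and> \<sigma> = the (\<rho> 0) \<and> \<sigma>' = the (\<rho> t) \<and>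
           \<omega> = on {0..t} (\<lambda>s. sat L (cur (the (\<rho> s))) (flat_pred L trm \<alpha> x)) \<and>
           \<theta> = on {0..t} (\<lambda>s. flat_enabled L \<alpha> x (the (\<rho> s))) \<and> p' = c x))"

lemma
  assumes "presents L \<alpha> I c p"
  shows presents_env: "env L p \<sigma> b p' \<sigma>' \<longleftrightarrow>
      (\<exists>x\<in>flat_locs \<alpha>. I \<sigma> x \<and> b = sat L (cur \<sigma>) (flat_pred L trm \<alpha> x) \<and> p' = c x)"
    and presents_act: "act L p \<sigma> a p' \<sigma>' \<longleftrightarrow>
      (\<exists>x x'. I \<sigma> x \<and> flat_step L \<alpha> x a x' \<sigma> \<sigma>' \<and> p' = c x')"
    and presents_time: "time L p \<sigma> \<rho> \<theta> \<omega> p' \<sigma>' \<longleftrightarrow>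
      (\<exists>x t. flat_flow L \<alpha> I x \<rho> t \<and> \<sigma> = the (\<rho> 0) \<and> \<sigma>' = the (\<rho> t) \<and>
         \<omega> = on {0..t} (\<lambda>s. sat L (cur (the (\<rho> s))) (flat_pred L trm \<alpha> x)) \<and>
         \<theta> = on {0..t} (\<lambda>s. flat_enabled L \<alpha> x (the (\<rho> s))) \<and> p' = c x)"
  using assms unfolding presents_def by simp_all

section \<open>Configurations and their invariance under fixing a location\<close>

definition cfg :: "('l, 'x, 'v, 'e) pred_lang \<Rightarrow> ('l, 'a, 'e) automaton \<Rightarrow> 'l \<times> 'l option
    \<Rightarrow> ('l, 'a, 'e) comp" where
  "cfg L \<alpha> = (\<lambda>(v, x). case x of
       None \<Rightarrow> Atom (at_loc L \<alpha> v)
     | Some w \<Rightarrow> Postfix (Atom (at_loc L (sub_aut \<alpha> v) w)) (at_loc L \<alpha> v))"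

lemma cfg_simps [simp]:
  "cfg L \<alpha> (v, None) = Atom (at_loc L \<alpha> v)"
  "cfg L \<alpha> (v, Some w) = Postfix (Atom (at_loc L (sub_aut \<alpha> v) w)) (at_loc L \<alpha> v)"
  by (simp_all add: cfg_def)

lemma flat_pred_simps [simp]:
  "flat_pred L f \<alpha> (v, None) = f \<alpha> v"
  "flat_pred L f \<alpha> (v, Some w) = conjp L (f \<alpha> v) (f (sub_aut \<alpha> v) w)"
  by (simp_all add: flat_pred_def)

lemma inner_pred_simps [simp]:
  "inner_pred L f \<alpha> (v, None) = truep L"
  "inner_pred L f \<alpha> (v, Some w) = f (sub_aut \<alpha> v) w"
  by (simp_all add: inner_pred_def)

lemma sub_aut_at_loc [simp]: "sub_aut (at_loc L \<alpha> u) v = sub_aut \<alpha> v"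
  by (simp add: sub_aut_def)

lemma flat_locs_at_loc [simp]: "flat_locs (at_loc L \<alpha> v) = flat_locs \<alpha>"
  by (simp add: flat_locs_def)

text \<open>\<open>inner_pred\<close> looks only at subautomata, so even \<open>f = init\<close> is
  unaffected by fixing the outer location.\<close>

lemma inner_pred_at_loc [simp]: "inner_pred L f (at_loc L \<alpha> v) = inner_pred L f \<alpha>"
  by (auto simp: inner_pred_def split: option.split)

lemma flat_edges_at_loc [simp]: "flat_edges L (at_loc L \<alpha> v) = flat_edges L \<alpha>"
  by (simp add: flat_edges_def)

lemma flat_pred_at_loc [simp]:
  "flat_pred L tcp (at_loc L \<alpha> v) = flat_pred L tcp \<alpha>"
  "flat_pred L trm (at_loc L \<alpha> v) = flat_pred L trm \<alpha>"
  by (auto simp: flat_pred_def split: option.split)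

lemma cfg_at_loc [simp]: "cfg L (at_loc L \<alpha> v) = cfg L \<alpha>"
  by (auto simp: cfg_def split: option.split)

text \<open>\<open>\<alpha>[v]\<close> differs from \<open>\<alpha>\<close> only in
  \<open>init\<close>, which \<open>presents\<close> sees solely through the parameter
  \<open>I\<close>. Hence a presentation of \<open>\<alpha>[v]\<close> over itself is one over
  \<open>\<alpha>\<close>.\<close>

lemma presents_at_loc [simp]: "presents L (at_loc L \<alpha> v) = presents L \<alpha>"
  by (intro ext) (simp add: presents_def flat_step_def flat_flow_def flat_enabled_def)

lemma flat_locs_None [simp]: "(v, None) \<in> flat_locs \<alpha> \<longleftrightarrow> v \<in> locs \<alpha> \<and> sub \<alpha> v = None"
  by (auto simp: flat_locs_def)

lemma flat_locs_Some [simp]: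
  "(v, Some w) \<in> flat_locs \<alpha> \<longleftrightarrow> v \<in> dom (sub \<alpha>) \<and> w \<in> locs (sub_aut \<alpha> v)"
  by (auto simp: flat_locs_def)

lemma flat_edges_in_flat_locs:
  "(x, g, a, r, x') \<in> flat_edges L \<alpha> \<Longrightarrow> x \<in> flat_locs \<alpha> \<and> x' \<in> flat_locs \<alpha>"
  by (auto simp: flat_edges_def)

lemma flat_step_in_flat_locs:
  "flat_step L \<alpha> x a x' \<sigma> \<sigma>' \<Longrightarrow> x \<in> flat_locs \<alpha> \<and> x' \<in> flat_locs \<alpha>"
  by (auto simp: flat_step_def dest: flat_edges_in_flat_locs)

section \<open>Bisimilarity from a common presentation\<close>

text \<open>Only the values of \<open>I\<close> on flat locations are ever consulted: flat edges
  start there, and the other two kinds of transitions ask for it explicitly.\<close>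

lemma presents_cong:
  assumes "\<And>\<sigma> x. x \<in> flat_locs \<alpha> \<Longrightarrow> I \<sigma> x \<longleftrightarrow> J \<sigma> x"
  shows "presents L \<alpha> I c p \<longleftrightarrow> presents L \<alpha> J c p"
proof -
  have "(\<exists>x\<in>flat_locs \<alpha>. I \<sigma> x \<and> P x) \<longleftrightarrow> (\<exists>x\<in>flat_locs \<alpha>. J \<sigma> x \<and> P x)" for \<sigma> P
    using assms by blast
  moreover have "I \<sigma> x \<and> flat_step L \<alpha> x a x' \<sigma> \<sigma>' \<and> P \<longleftrightarrow> J \<sigma> x \<and> flat_step L \<alpha> x a x' \<sigma> \<sigma>' \<and> P"
    for \<sigma> x a x' \<sigma>' P
    using assms by (blast dest: flat_step_in_flat_locs)
  moreover have "flat_flow L \<alpha> I x \<rho> t \<longleftrightarrow> flat_flow L \<alpha> J x \<rho> t" for x \<rho> t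
    unfolding flat_flow_def using assms by blast
  ultimately show ?thesis by (simp add: presents_def)
qed

text \<open>The relation consists of \<open>(p, q)\<close> and the pairs \<open>(c x, d x)\<close>,
  closed under converse. Labels depend only on \<open>I\<close> and the flat data, and every target
  is determined by its flat location, so a matching step ends at the same \<open>x\<close> on both
  sides.\<close>

lemma stateless_bisimulation_presents:
  assumes c: "\<And>x. x \<in> flat_locs \<alpha> \<Longrightarrow> presents L \<alpha> (\<lambda>_. (=) x) c (c x) \<and> wf_comp L (c x)"
    and d: "\<And>x. x \<in> flat_locs \<alpha> \<Longrightarrow> presents L \<alpha> (\<lambda>_. (=) x) d (d x) \<and> wf_comp L (d x)"
    and p: "presents L \<alpha> I c p" "wf_comp L p"
    and q: "presents L \<alpha> I d q" "wf_comp L q"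
  shows "stateless_bisimilar L p q"
proof -
  define R where "R = insert (p, q) ((\<lambda>x. (c x, d x)) ` flat_locs \<alpha>)"
  have wf: "wf_comp L p' \<and> wf_comp L q'" if "(p', q') \<in> R" for p' q'
    using that c d p q by (auto simp: R_def)
  \<comment> \<open>The witness is \<open>I\<close> for \<open>(p, q)\<close> and equality with
    \<open>x\<close> for \<open>(c x, d x)\<close>; both components share it.\<close>
  have pres: "\<exists>J. presents L \<alpha> J c p' \<and> presents L \<alpha> J d q'" if "(p', q') \<in> R" for p' q'
    using that p(1) q(1) c d unfolding R_def by blast
  have R: "(c x, d x) \<in> R" if "x \<in> flat_locs \<alpha>" for x
    using that by (simp add: R_def)
  \<comment> \<open>Kept general in \<open>f\<close>, \<open>g\<close> and \<open>S\<close>, so that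
    it serves both directions of the symmetric closure by exchanging \<open>c\<close> and
    \<open>d\<close>.\<close>
  have match:
    "(\<forall>a. act L p1 \<sigma> a p' \<sigma>' \<longrightarrow> (\<exists>q'. act L q1 \<sigma> a q' \<sigma>' \<and> (p', q') \<in> S)) \<and>
     (\<forall>\<rho> \<theta> \<omega>. time L p1 \<sigma> \<rho> \<theta> \<omega> p' \<sigma>' \<longrightarrow> (\<exists>q'. time L q1 \<sigma> \<rho> \<theta> \<omega> q' \<sigma>' \<and> (p', q') \<in> S)) \<and>
     (\<forall>b. env L p1 \<sigma> b p' \<sigma>' \<longrightarrow> (\<exists>q'. env L q1 \<sigma> b q' \<sigma>' \<and> (p', q') \<in> S))"
    if P: "presents L \<alpha> J f p1" and Q: "presents L \<alpha> J g q1"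
      and S: "\<And>x. x \<in> flat_locs \<alpha> \<Longrightarrow> (f x, g x) \<in> S" for J f g p1 q1 S \<sigma> p' \<sigma>'
  proof (intro conjI allI impI)
    fix a assume "act L p1 \<sigma> a p' \<sigma>'"
    then obtain x x' where x: "J \<sigma> x" "flat_step L \<alpha> x a x' \<sigma> \<sigma>'" and p': "p' = f x'"
      unfolding presents_act[OF P] by blast
    have "act L q1 \<sigma> a (g x') \<sigma>'"
      unfolding presents_act[OF Q] using x by blast
    moreover have "(p', g x') \<in> S" unfolding p' using S flat_step_in_flat_locs[OF x(2)] by blast
    ultimately show "\<exists>q'. act L q1 \<sigma> a q' \<sigma>' \<and> (p', q') \<in> S" by blast
  next
    fix \<rho> \<theta> \<omega> assume "time L p1 \<sigma> \<rho> \<theta> \<omega> p' \<sigma>'"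
    then obtain x t where x: "flat_flow L \<alpha> J x \<rho> t \<and> \<sigma> = the (\<rho> 0) \<and> \<sigma>' = the (\<rho> t) \<and>
           \<omega> = on {0..t} (\<lambda>s. sat L (cur (the (\<rho> s))) (flat_pred L trm \<alpha> x)) \<and>
           \<theta> = on {0..t} (\<lambda>s. flat_enabled L \<alpha> x (the (\<rho> s)))" "p' = f x"
      unfolding presents_time[OF P] by blast
    have "time L q1 \<sigma> \<rho> \<theta> \<omega> (g x) \<sigma>'"
      unfolding presents_time[OF Q] using x(1) by blast
    moreover have "(p', g x) \<in> S" using S x by (auto simp: flat_flow_def)
    ultimately show "\<exists>q'. time L q1 \<sigma> \<rho> \<theta> \<omega> q' \<sigma>' \<and> (p', q') \<in> S" by blast
  next
    fix b assume "env L p1 \<sigma> b p' \<sigma>'"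
    then obtain x where x: "x \<in> flat_locs \<alpha>" "J \<sigma> x"
        "b = sat L (cur \<sigma>) (flat_pred L trm \<alpha> x)" "p' = f x"
      unfolding presents_env[OF P] by blast
    then have "env L q1 \<sigma> b (g x) \<sigma>'"
      unfolding presents_env[OF Q] by blast
    then show "\<exists>q'. env L q1 \<sigma> b q' \<sigma>' \<and> (p', q') \<in> S"
      using S x by blast
  qed
  have "stateless_bisimulation L (R \<union> R\<inverse>)"
    unfolding stateless_bisimulation_def
  proof (intro conjI)
    show "R \<union> R\<inverse> \<subseteq> {p. wf_comp L p} \<times> {p. wf_comp L p}" by (auto dest: wf)
    show "sym (R \<union> R\<inverse>)" by (rule sym_Un_converse)
    show "\<forall>(p, q)\<in>R \<union> R\<inverse>. \<forall>\<sigma> p' \<sigma>'.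
        (\<forall>a. act L p \<sigma> a p' \<sigma>' \<longrightarrow> (\<exists>q'. act L q \<sigma> a q' \<sigma>' \<and> (p', q') \<in> R \<union> R\<inverse>)) \<and>
        (\<forall>\<rho> \<theta> \<omega>. time L p \<sigma> \<rho> \<theta> \<omega> p' \<sigma>' \<longrightarrow> (\<exists>q'. time L q \<sigma> \<rho> \<theta> \<omega> q' \<sigma>' \<and> (p', q') \<in> R \<union> R\<inverse>)) \<and>
        (\<forall>b. env L p \<sigma> b p' \<sigma>' \<longrightarrow> (\<exists>q'. env L q \<sigma> b q' \<sigma>' \<and> (p', q') \<in> R \<union> R\<inverse>))"
    proof (intro ballI, clarify intro!: allI del: conjI)
      fix p1 q1 \<sigma> p' \<sigma>' assume "(p1, q1) \<in> R \<union> R\<inverse>"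
      then consider "(p1, q1) \<in> R" | "(q1, p1) \<in> R" by blast
      then show "(\<forall>a. act L p1 \<sigma> a p' \<sigma>' \<longrightarrow> (\<exists>q'. act L q1 \<sigma> a q' \<sigma>' \<and> (p', q') \<in> R \<union> R\<inverse>)) \<and>
        (\<forall>\<rho> \<theta> \<omega>. time L p1 \<sigma> \<rho> \<theta> \<omega> p' \<sigma>' \<longrightarrow> (\<exists>q'. time L q1 \<sigma> \<rho> \<theta> \<omega> q' \<sigma>' \<and> (p', q') \<in> R \<union> R\<inverse>)) \<and>
        (\<forall>b. env L p1 \<sigma> b p' \<sigma>' \<longrightarrow> (\<exists>q'. env L q1 \<sigma> b q' \<sigma>' \<and> (p', q') \<in> R \<union> R\<inverse>))"
      proof cases
        case 1
        then obtain J where "presents L \<alpha> J c p1" "presents L \<alpha> J d q1" using pres by blast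
        then show ?thesis by (rule match) (simp add: R)
      next
        case 2
        then obtain J where "presents L \<alpha> J c q1" "presents L \<alpha> J d p1" using pres by blast
        then show ?thesis by (intro match[where f = d and g = c]) (simp_all add: R)
      qed
    qed
  qed
  then show ?thesis by (auto simp: stateless_bisimilar_def R_def)
qed

section \<open>Well-formedness of two-level automata and of their flattening\<close>

locale two_level =
  fixes L :: "('l, 'x, 'v, 'e) pred_lang" and \<alpha> :: "('l, 'a, 'e) automaton"
  assumes lang: "predicate_language L"
    and wf: "wf_automaton L \<alpha>"
    and flat_subs: "\<forall>v\<in>dom (sub \<alpha>). \<exists>\<beta>. sub \<alpha> v = Some (Atom \<beta>) \<and> flat \<beta>"
begin

lemma sat_simps [simp]:
  "sat L m (conjp L e f) \<longleftrightarrow> sat L m e \<and> sat L m f"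
  "sat L m (truep L)"
  "sat L m (eqp L v w) \<longleftrightarrow> v = w"
  "e \<in> Pt L \<Longrightarrow> sat L (stp \<sigma>' ++ cur \<sigma>) (stepp L e) \<longleftrightarrow> sat L (cur \<sigma>') e"
  using lang by (auto simp: predicate_language_def)

lemma closed:
  "e \<in> Pt L \<Longrightarrow> f \<in> Pt L \<Longrightarrow> conjp L e f \<in> Pt L"
  "e \<in> Pt L \<Longrightarrow> g \<in> Pg L \<Longrightarrow> conjp L e g \<in> Pg L"
  "r \<in> Pr L \<Longrightarrow> e \<in> Pt L \<Longrightarrow> conjp L r (stepp L e) \<in> Pr L"
  "truep L \<in> Pt L"
  using lang unfolding predicate_language_def by blast+

text \<open>Allows results proved in the locale for \<open>\<alpha>\<close> to be reused for
  \<open>\<alpha>[v]\<close>.\<close>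

lemma two_level_at_loc: "two_level L (at_loc L \<alpha> v)"
  using lang wf flat_subs by unfold_locales (auto intro: wf_automaton_at_loc)

lemma wf_locs:
  "locs \<alpha> \<noteq> {}" "dom (sub \<alpha>) \<subseteq> locs \<alpha>"
  "edges \<alpha> \<subseteq> locs \<alpha> \<times> Pg L \<times> UNIV \<times> Pr L \<times> locs \<alpha>"
  and wf_preds: "v \<in> locs \<alpha> \<Longrightarrow> init \<alpha> v \<in> Pt L" "v \<in> locs \<alpha> \<Longrightarrow> tcp \<alpha> v \<in> Pt L"
    "v \<in> locs \<alpha> \<Longrightarrow> trm \<alpha> v \<in> Pt L"
  and wf_sub: "sub \<alpha> v = Some q \<Longrightarrow> wf_comp L q"
  using wf by (cases rule: wf_automaton.cases; auto simp: image_subset_iff subset_iff dom_def)+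

text \<open>Resolves the selectors \<open>the\<close> and \<open>the_automaton\<close> hidden in
  \<open>sub_aut\<close>; used below as local rewrite rules wherever a location has a
  substructure.\<close>

lemma sub_Some:
  assumes "sub \<alpha> v = Some q"
  shows "q = Atom (sub_aut \<alpha> v)" "sub (sub_aut \<alpha> v) = Map.empty" "wf_automaton L (sub_aut \<alpha> v)"
    "v \<in> locs \<alpha>"
proof -
  obtain \<beta> where "sub \<alpha> v = Some (Atom \<beta>)" "flat \<beta>"
    using assms flat_subs by blast
  moreover have "wf_automaton L \<beta>"
    using wf_sub[OF calculation(1)] by (auto elim: wf_comp.cases)
  ultimately show "q = Atom (sub_aut \<alpha> v)" "sub (sub_aut \<alpha> v) = Map.empty"
    "wf_automaton L (sub_aut \<alpha> v)"
    using assms by (auto simp: sub_aut_def flat_iff)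
  show "v \<in> locs \<alpha>" using assms wf_locs by blast
qed

lemma wf_sub_aut:
  assumes "v \<in> dom (sub \<alpha>)"
  shows "locs (sub_aut \<alpha> v) \<noteq> {}"
    and "edges (sub_aut \<alpha> v) \<subseteq> locs (sub_aut \<alpha> v) \<times> Pg L \<times> UNIV \<times> Pr L \<times> locs (sub_aut \<alpha> v)"
    and "w \<in> locs (sub_aut \<alpha> v) \<Longrightarrow> init (sub_aut \<alpha> v) w \<in> Pt L"
    and "w \<in> locs (sub_aut \<alpha> v) \<Longrightarrow> tcp (sub_aut \<alpha> v) w \<in> Pt L"
    and "w \<in> locs (sub_aut \<alpha> v) \<Longrightarrow> trm (sub_aut \<alpha> v) w \<in> Pt L"
  by (rule wf_automaton.cases[of L "sub_aut \<alpha> v"]; use sub_Some(3) assms in \<open>auto simp: image_subset_iff\<close>)+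

lemma fst_flat_locs: "(v, x) \<in> flat_locs \<alpha> \<Longrightarrow> v \<in> locs \<alpha>"
  using wf_locs(2) by (cases x) auto

text \<open>Either \<open>(v, None)\<close> or, since a substructure has a location, some
  \<open>(v, Some w)\<close>. This provides the target of a flat edge for every edge of
  \<open>\<alpha>\<close>.\<close>

lemma flat_locs_nonempty: "v \<in> locs \<alpha> \<Longrightarrow> \<exists>x. (v, x) \<in> flat_locs \<alpha>"
  using wf_sub_aut(1)[of v] by (cases "sub \<alpha> v") (auto simp: split_option_ex)

text \<open>Besides well-formedness of the flattening, this licenses evaluating \<open>stepp\<close>
  in flat resets, whose semantics is fixed only on \<open>Pt L\<close>.\<close>

lemma inner_pred_in_Pt:
  assumes "x \<in> flat_locs \<alpha>"
  shows "inner_pred L init \<alpha> x \<in> Pt L" "inner_pred L trm \<alpha> x \<in> Pt L"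
proof (atomize (full), cases x)
  case (Pair v y)
  show "inner_pred L init \<alpha> x \<in> Pt L \<and> inner_pred L trm \<alpha> x \<in> Pt L"
    using assms Pair wf_sub_aut(3,5)[of v] by (cases y) (auto intro: closed)
qed

lemma flat_pred_in_Pt:
  assumes "x \<in> flat_locs \<alpha>"
  shows "flat_pred L init \<alpha> x \<in> Pt L" "flat_pred L tcp \<alpha> x \<in> Pt L" "flat_pred L trm \<alpha> x \<in> Pt L"
proof (atomize (full), cases x)
  case (Pair v y)
  show "flat_pred L init \<alpha> x \<in> Pt L \<and> flat_pred L tcp \<alpha> x \<in> Pt L \<and> flat_pred L trm \<alpha> x \<in> Pt L"
    using assms Pair wf_preds[of v] wf_sub_aut(3-5)[of v] fst_flat_locs[of v y]
    by (cases y) (auto intro!: closed)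
qed

lemma wf_enc:
  assumes "inj enc_pair"
  shows "wf_automaton L (enc L enc_pair \<alpha>)"
proof (rule wf_automaton_wf_comp.intros(1))
  show "locs (enc L enc_pair \<alpha>) \<noteq> {}"
    using wf_locs(1) flat_locs_nonempty by (auto simp: enc_def)
  \<comment> \<open>Outer edges rely on the mixed closure conditions for guards and resets; inner
    edges inherit the property from the subautomaton.\<close>
  have "g \<in> Pg L \<and> r \<in> Pr L" if "(x, g, a, r, x') \<in> flat_edges L \<alpha>" for x g a r x'
    using that unfolding flat_edges_def
  proof (elim UnE CollectE exE conjE, goal_cases)
    case (1 v0 x0 g0 a0 r0 v1 x1)
    then have "g0 \<in> Pg L" "r0 \<in> Pr L" using wf_locs(3) by blast+
    then show ?case
      using 1 inner_pred_in_Pt(2)[of "(v0, x0)"] inner_pred_in_Pt(1)[of "(v1, x1)"]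
      by (auto intro: closed)
  next
    case (2 v w0 g' a' r' w1)
    then show ?case using wf_sub_aut(2)[of v] by blast
  qed
  then show "edges (enc L enc_pair \<alpha>)
    \<subseteq> locs (enc L enc_pair \<alpha>) \<times> Pg L \<times> UNIV \<times> Pr L \<times> locs (enc L enc_pair \<alpha>)"
    using flat_edges_in_flat_locs by (fastforce simp: enc_def)
qed (use assms flat_pred_in_Pt in \<open>auto simp: enc_def\<close>)

section \<open>Enabled actions and steps of the flattening\<close>

lemma flat_edges_outer:
  assumes "(v, g, a, r, v') \<in> edges \<alpha>" "(v, x) \<in> flat_locs \<alpha>" "(v', x') \<in> flat_locs \<alpha>"
  shows "((v, x), conjp L (inner_pred L trm \<alpha> (v, x)) g, a,
     conjp L r (stepp L (inner_pred L init \<alpha> (v', x'))), (v', x')) \<in> flat_edges L \<alpha>"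
  using assms unfolding flat_edges_def by blast

lemma flat_edges_inner:
  assumes "(w, g, a, r, w') \<in> edges (sub_aut \<alpha> v)" "v \<in> dom (sub \<alpha>)"
  shows "((v, Some w), g, a, r, (v, Some w')) \<in> flat_edges L \<alpha>"
proof -
  have "w \<in> locs (sub_aut \<alpha> v)" "w' \<in> locs (sub_aut \<alpha> v)"
    using assms wf_sub_aut(2) by blast+
  then show ?thesis using assms unfolding flat_edges_def by blast
qed

text \<open>Enabledness depends on the guard alone, so any flat location above the target will do,
  whether or not it can be entered.\<close>

lemma flat_enabled_None:
  assumes "(v, None) \<in> flat_locs \<alpha>"
  shows "flat_enabled L \<alpha> (v, None) \<sigma> = enabled L \<alpha> v \<sigma>"
proof -
  have "a \<in> flat_enabled L \<alpha> (v, None) \<sigma>" if "(v, g, a, r, v') \<in> edges \<alpha>" "sat L (cur \<sigma>) g" for g a r v'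
  proof -
    have "v' \<in> locs \<alpha>" using that wf_locs(3) by blast
    then obtain x' where "(v', x') \<in> flat_locs \<alpha>"
      using flat_locs_nonempty by blast
    then show ?thesis
      by (rule flat_enabledI[OF flat_edges_outer[OF that(1) assms]]) (simp add: that)
  qed
  then have "enabled L \<alpha> v \<sigma> \<subseteq> flat_enabled L \<alpha> (v, None) \<sigma>"
    by (auto simp: enabled_def)
  moreover have "flat_enabled L \<alpha> (v, None) \<sigma> \<subseteq> enabled L \<alpha> v \<sigma>"
    by (fastforce simp: enabled_def flat_enabled_def flat_edges_def)
  ultimately show ?thesis by (rule equalityI[rotated])
qed

text \<open>The termination conjunct of an outer flat guard is exactly the filter that
  \<open>time.Atom_sub\<close> and \<open>time.Postfix\<close> impose through the inner termination
  trajectory.\<close>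

lemma flat_enabled_Some:
  assumes "(v, Some w) \<in> flat_locs \<alpha>"
  shows "flat_enabled L \<alpha> (v, Some w) \<sigma> = enabled L (sub_aut \<alpha> v) w \<sigma> \<union>
    {a \<in> enabled L \<alpha> v \<sigma>. sat L (cur \<sigma>) (trm (sub_aut \<alpha> v) w)}"
proof (rule equalityI)
  have "a \<in> flat_enabled L \<alpha> (v, Some w) \<sigma>"
    if "(v, g, a, r, v') \<in> edges \<alpha>" "sat L (cur \<sigma>) g" "sat L (cur \<sigma>) (trm (sub_aut \<alpha> v) w)" for g a r v'
  proof -
    have "v' \<in> locs \<alpha>" using that wf_locs(3) by blast
    then obtain x' where "(v', x') \<in> flat_locs \<alpha>"
      using flat_locs_nonempty by blast
    then show ?thesis
      by (rule flat_enabledI[OF flat_edges_outer[OF that(1) assms]]) (simp add: that)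
  qed
  moreover have "a \<in> flat_enabled L \<alpha> (v, Some w) \<sigma>"
    if "(w, g, a, r, w') \<in> edges (sub_aut \<alpha> v)" "sat L (cur \<sigma>) g" for g a r w'
    using flat_enabledI[OF flat_edges_inner[OF that(1)]] that(2) assms by auto
  ultimately show "enabled L (sub_aut \<alpha> v) w \<sigma> \<union>
      {a \<in> enabled L \<alpha> v \<sigma>. sat L (cur \<sigma>) (trm (sub_aut \<alpha> v) w)} \<subseteq> flat_enabled L \<alpha> (v, Some w) \<sigma>"
    by (auto simp: enabled_def)
qed (fastforce simp: enabled_def flat_enabled_def flat_edges_def)

text \<open>Evaluates the conjunctions built by flattening: termination is tested at
  \<open>\<sigma>\<close>, while the step version of the inner initialization reads
  \<open>\<sigma>'\<close>.\<close>

lemma flat_step_iff: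
  "flat_step L \<alpha> (v, x) a (v', x') \<sigma> \<sigma>' \<longleftrightarrow>
     (v, x) \<in> flat_locs \<alpha> \<and> (v', x') \<in> flat_locs \<alpha> \<and>
     ((\<exists>g r. (v, g, a, r, v') \<in> edges \<alpha> \<and> sat L (cur \<sigma>) g \<and> sat L (stp \<sigma>' ++ cur \<sigma>) r \<and>
         sat L (cur \<sigma>) (inner_pred L trm \<alpha> (v, x)) \<and> sat L (cur \<sigma>') (inner_pred L init \<alpha> (v', x'))) \<or>
      (\<exists>w g r w'. x = Some w \<and> x' = Some w' \<and> v' = v \<and> (w, g, a, r, w') \<in> edges (sub_aut \<alpha> v) \<and>
         sat L (cur \<sigma>) g \<and> sat L (stp \<sigma>' ++ cur \<sigma>) r))" (is "?l \<longleftrightarrow> ?r")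
proof
  assume l: ?l
  then obtain g' r' where e: "((v, x), g', a, r', (v', x')) \<in> flat_edges L \<alpha>"
    and s: "sat L (cur \<sigma>) g'" "sat L (stp \<sigma>' ++ cur \<sigma>) r'"
    unfolding flat_step_def by blast
  have locs: "(v, x) \<in> flat_locs \<alpha>" "(v', x') \<in> flat_locs \<alpha>"
    using flat_edges_in_flat_locs[OF e] by simp_all
  from e consider (outer) g r where "g' = conjp L (inner_pred L trm \<alpha> (v, x)) g"
      "r' = conjp L r (stepp L (inner_pred L init \<alpha> (v', x')))" "(v, g, a, r, v') \<in> edges \<alpha>"
    | (inner) w w' where "x = Some w" "x' = Some w'" "v' = v"
      "(w, g', a, r', w') \<in> edges (sub_aut \<alpha> v)"
    unfolding flat_edges_def by blast
  then show ?r
  proof cases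
    case outer
    then show ?thesis using s locs inner_pred_in_Pt(1)[OF locs(2)] sat_simps(1,4) by metis
  next
    case inner
    then show ?thesis using s locs by blast
  qed
next
  assume r: ?r
  then have locs: "(v, x) \<in> flat_locs \<alpha>" "(v', x') \<in> flat_locs \<alpha>" by simp_all
  from r consider (outer) g r where "(v, g, a, r, v') \<in> edges \<alpha>" "sat L (cur \<sigma>) g"
      "sat L (stp \<sigma>' ++ cur \<sigma>) r" "sat L (cur \<sigma>) (inner_pred L trm \<alpha> (v, x))"
      "sat L (cur \<sigma>') (inner_pred L init \<alpha> (v', x'))"
    | (inner) w g r w' where "x = Some w" "x' = Some w'" "v' = v"
      "(w, g, a, r, w') \<in> edges (sub_aut \<alpha> v)" "sat L (cur \<sigma>) g" "sat L (stp \<sigma>' ++ cur \<sigma>) r"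
    by blast
  then show ?l
  proof cases
    case outer
    show ?thesis
      using outer inner_pred_in_Pt(1)[OF locs(2)]
      by (intro flat_stepI[OF flat_edges_outer[OF outer(1) locs]]) simp_all
  next
    case inner
    then have "v \<in> dom (sub \<alpha>)" using locs by simp
    then show ?thesis using inner flat_stepI[OF flat_edges_inner] by blast
  qed
qed

section \<open>Action transitions of the hierarchical automaton\<close>

text \<open>Merges the rules for targets with and without substructure, for atomic and postfix
  sources alike; \<open>\<sigma>\<close> is the valuation after the step, and the label
  \<open>b\<close> is free, so termination is not asked for on entry.\<close>

definition enters where
  "enters v \<sigma> p \<longleftrightarrow> (\<exists>h b q. sub \<alpha> v = Some h \<and> env L h \<sigma> b q \<sigma> \<and> p = Postfix q (at_loc L \<alpha> v)) \<or>
     sub \<alpha> v = None \<and> p = Atom (at_loc L \<alpha> v)"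

lemma enters_iff:
  assumes "v \<in> locs \<alpha>"
  shows "enters v \<sigma> p \<longleftrightarrow> (\<exists>x. (v, x) \<in> flat_locs \<alpha> \<and> sat L (cur \<sigma>) (inner_pred L init \<alpha> (v, x)) \<and>
    p = cfg L \<alpha> (v, x))"
proof (cases "sub \<alpha> v")
  case None
  then show ?thesis using assms
    by (auto simp: enters_def split_option_ex)
next
  case (Some h)
  note [simp] = sub_Some[OF Some]
  show ?thesis using Some
    by (auto simp: enters_def split_option_ex env_Atom_flat)
qed

definition exits where
  "exits v \<sigma> \<longleftrightarrow> (\<exists>h p. sub \<alpha> v = Some h \<and> env L h \<sigma> True p \<sigma>) \<or> sub \<alpha> v = None"

text \<open>One environment step of a flat substructure tests initialization and termination at the
  same location \<open>w\<close>. Both thus hold at a common flat location, which can serve as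
  source of the flat step.\<close>

lemma exits_iff:
  assumes "v \<in> locs \<alpha>"
  shows "exits v \<sigma> \<longleftrightarrow> (\<exists>x. (v, x) \<in> flat_locs \<alpha> \<and> sat L (cur \<sigma>) (inner_pred L init \<alpha> (v, x)) \<and>
    sat L (cur \<sigma>) (inner_pred L trm \<alpha> (v, x)))"
proof (cases "sub \<alpha> v")
  case None
  then show ?thesis using assms
    by (auto simp: exits_def split_option_ex)
next
  case (Some h)
  note [simp] = sub_Some[OF Some]
  show ?thesis using Some
    by (auto simp: exits_def split_option_ex env_Atom_flat)
qed

lemma sat_flat_pred:
  "sat L m (flat_pred L f \<alpha> (v, x)) \<longleftrightarrow> sat L m (f \<alpha> v) \<and> sat L m (inner_pred L f \<alpha> (v, x))"
  by (cases x) auto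

lemma act_Atom_iff:
  "act L (Atom \<alpha>) \<sigma> a p \<sigma>' \<longleftrightarrow>
     (\<exists>v g r v'. edge L \<alpha> v g a r v' \<sigma> \<sigma>' \<and> exits v \<sigma> \<and> enters v' \<sigma>' p) \<or>
     (\<exists>v h q. v \<in> locs \<alpha> \<and> sat L (cur \<sigma>) (init \<alpha> v) \<and> sub \<alpha> v = Some h \<and> act L h \<sigma> a q \<sigma>' \<and>
        p = Postfix q (at_loc L \<alpha> v))" (is "?l \<longleftrightarrow> ?r")
proof
  assume ?l
  then show ?r
    unfolding exits_def enters_def by cases blast+
next
  assume ?r
  then show ?l
    unfolding exits_def enters_def
    by (elim disjE exE conjE) (blast intro: act.intros)+
qed

text \<open>The initialization predicate of \<open>\<alpha>[v]\<close> at a location is its equality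
  with \<open>v\<close>, so every outer edge taken must start at \<open>v\<close>.\<close>

lemma act_Postfix_iff:
  "act L (Postfix p (at_loc L \<alpha> v)) \<sigma> a p' \<sigma>' \<longleftrightarrow>
     (\<exists>g r v' p''. (v, g, a, r, v') \<in> edges \<alpha> \<and> sat L (cur \<sigma>) g \<and> sat L (stp \<sigma>' ++ cur \<sigma>) r \<and>
        env L p \<sigma> True p'' \<sigma> \<and> enters v' \<sigma>' p') \<or>
     (\<exists>q. act L p \<sigma> a q \<sigma>' \<and> p' = Postfix q (at_loc L \<alpha> v))" (is "?l \<longleftrightarrow> ?r")
proof
  assume ?l
  then show ?r
  proof cases
    case (Postfix_to_sub v0 g r v' p'' h b q)
    then show ?thesis by (simp add: edge_def enters_def) blast
  next
    case (Postfix_to_nosub v0 g r v' p'')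
    then show ?thesis by (simp add: edge_def enters_def) blast
  next
    case (Postfix_inner q)
    then show ?thesis by blast
  qed
next
  assume ?r
  then consider (outer) g r v' p'' where "edge L (at_loc L \<alpha> v) v g a r v' \<sigma> \<sigma>'"
      "env L p \<sigma> True p'' \<sigma>" "enters v' \<sigma>' p'"
    | (inner) q where "act L p \<sigma> a q \<sigma>'" "p' = Postfix q (at_loc L \<alpha> v)"
    by (auto simp: edge_def)
  then show ?l
  proof cases
    case outer
    show ?thesis
      using outer(3) act.Postfix_to_sub[OF outer(1,2)] act.Postfix_to_nosub[OF outer(1,2)]
      unfolding enters_def at_loc_simps by blast
  next
    case inner
    then show ?thesis by (blast intro: act.Postfix_inner)
  qed
qed

lemma act_Atom_presented:
  "act L (Atom \<alpha>) \<sigma> a p \<sigma>' \<longleftrightarrow> (\<exists>x x'. sat L (cur \<sigma>) (flat_pred L init \<alpha> x) \<and>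
     flat_step L \<alpha> x a x' \<sigma> \<sigma>' \<and> p = cfg L \<alpha> x')" (is "?l \<longleftrightarrow> ?r")
proof
  assume ?l
  then consider (outer) v g r v' where "edge L \<alpha> v g a r v' \<sigma> \<sigma>'" "exits v \<sigma>" "enters v' \<sigma>' p"
    | (inner) v h q where "v \<in> locs \<alpha>" "sat L (cur \<sigma>) (init \<alpha> v)" "sub \<alpha> v = Some h"
        "act L h \<sigma> a q \<sigma>'" "p = Postfix q (at_loc L \<alpha> v)"
    unfolding act_Atom_iff by blast
  then show ?r
  proof cases
    case outer
    then have "v \<in> locs \<alpha>" "v' \<in> locs \<alpha>" using wf_locs(3) by (auto simp: edge_def)
    \<comment> \<open>\<open>exits_iff\<close> gives the source and \<open>enters_iff\<close> the
      target. The choices are independent, since an outer edge is copied to all pairs of flat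
      locations above its ends.\<close>
    then obtain x x' where "(v, x) \<in> flat_locs \<alpha>" "sat L (cur \<sigma>) (inner_pred L init \<alpha> (v, x))"
      "sat L (cur \<sigma>) (inner_pred L trm \<alpha> (v, x))" "(v', x') \<in> flat_locs \<alpha>"
      "sat L (cur \<sigma>') (inner_pred L init \<alpha> (v', x'))" "p = cfg L \<alpha> (v', x')"
      using outer enters_iff exits_iff by metis
    then show ?thesis using outer(1)
      by (intro exI[of _ "(v, x)"] exI[of _ "(v', x')"])
        (auto simp: edge_def flat_step_iff sat_flat_pred simp del: flat_pred_simps)
  next
    case inner
    note s [simp] = sub_Some[OF inner(3)]
    obtain w g r w' where w: "edge L (sub_aut \<alpha> v) w g a r w' \<sigma> \<sigma>'"
      "q = Atom (at_loc L (sub_aut \<alpha> v) w')"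
      using inner(4) by (auto simp: act_Atom_flat)
    moreover have "w \<in> locs (sub_aut \<alpha> v)" "w' \<in> locs (sub_aut \<alpha> v)"
      using wf_sub_aut(2)[of v] w inner(3) by (auto simp: edge_def)
    \<comment> \<open>\<open>edge\<close> for the subautomaton includes its initialization at
      \<open>w\<close>; together with that of \<open>\<alpha>\<close> at \<open>v\<close>, the pair
      \<open>(v, Some w)\<close> is initial.\<close>
    ultimately show ?thesis using inner
      by (intro exI[of _ "(v, Some w)"] exI[of _ "(v, Some w')"])
        (auto simp: edge_def flat_step_iff)
  qed
next
  assume ?r
  then obtain v x v' x' where i: "sat L (cur \<sigma>) (flat_pred L init \<alpha> (v, x))"
    and st: "flat_step L \<alpha> (v, x) a (v', x') \<sigma> \<sigma>'" and p: "p = cfg L \<alpha> (v', x')"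
    by auto
  have l: "(v, x) \<in> flat_locs \<alpha>" "(v', x') \<in> flat_locs \<alpha>" "v \<in> locs \<alpha>" "v' \<in> locs \<alpha>"
    using flat_step_in_flat_locs[OF st] fst_flat_locs by auto
  from st consider (outer) g r where "(v, g, a, r, v') \<in> edges \<alpha>" "sat L (cur \<sigma>) g"
      "sat L (stp \<sigma>' ++ cur \<sigma>) r" "sat L (cur \<sigma>) (inner_pred L trm \<alpha> (v, x))"
      "sat L (cur \<sigma>') (inner_pred L init \<alpha> (v', x'))"
    | (inner) w g r w' where "x = Some w" "x' = Some w'" "v' = v"
      "(w, g, a, r, w') \<in> edges (sub_aut \<alpha> v)" "sat L (cur \<sigma>) g" "sat L (stp \<sigma>' ++ cur \<sigma>) r"
    unfolding flat_step_iff by blast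
  then show ?l
  proof cases
    case outer
    have "edge L \<alpha> v g a r v' \<sigma> \<sigma>'" using outer i by (simp add: edge_def sat_flat_pred)
    moreover have "exits v \<sigma>" using l outer i sat_flat_pred exits_iff by blast
    moreover have "enters v' \<sigma>' p" using l outer p enters_iff by blast
    ultimately show ?thesis unfolding act_Atom_iff by blast
  next
    case inner
    then obtain h where h: "sub \<alpha> v = Some h" using l by auto
    note [simp] = sub_Some[OF h]
    have "sat L (cur \<sigma>) (init \<alpha> v)" using i inner by simp
    moreover have "act L h \<sigma> a (Atom (at_loc L (sub_aut \<alpha> v) w')) \<sigma>'"
      using inner i by (auto simp: act_Atom_flat edge_def)
    ultimately have "act L (Atom \<alpha>) \<sigma> a
        (Postfix (Atom (at_loc L (sub_aut \<alpha> v) w')) (at_loc L \<alpha> v)) \<sigma>'"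
      using l(3) h by (intro act.Atom_inner)
    then show ?thesis using p inner by simp
  qed
qed

lemma act_Postfix_presented:
  assumes vw: "(v, Some w) \<in> flat_locs \<alpha>"
  shows "act L (cfg L \<alpha> (v, Some w)) \<sigma> a p \<sigma>' \<longleftrightarrow>
    (\<exists>x'. flat_step L \<alpha> (v, Some w) a x' \<sigma> \<sigma>' \<and> p = cfg L \<alpha> x')"
proof -
  obtain h where h: "sub \<alpha> v = Some h" using vw by auto
  note [simp] = sub_Some[OF h]
  have w: "w \<in> locs (sub_aut \<alpha> v)" using vw by simp
  have e: "v' \<in> locs \<alpha>" if "(v, g, a, r, v') \<in> edges \<alpha>" for g r v'
    using that wf_locs(3) by blast
  have e': "w' \<in> locs (sub_aut \<alpha> v)" if "(w, g, a, r, w') \<in> edges (sub_aut \<alpha> v)" for g r w'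
    using that wf_sub_aut(2)[of v] h by blast
  let ?q = "Atom (at_loc L (sub_aut \<alpha> v) w)"
  \<comment> \<open>The only location in which \<open>?q\<close> can be is \<open>w\<close>, so the
    condition for leaving it reduces to termination at \<open>w\<close>.\<close>
  have env: "(\<exists>p''. env L ?q \<sigma> True p'' \<sigma>) \<longleftrightarrow> sat L (cur \<sigma>) (trm (sub_aut \<alpha> v) w)"
    using w by (auto simp: env_Atom_flat)
  have act: "act L ?q \<sigma> a q \<sigma>' \<longleftrightarrow> (\<exists>g r w'. (w, g, a, r, w') \<in> edges (sub_aut \<alpha> v) \<and>
      sat L (cur \<sigma>) g \<and> sat L (stp \<sigma>' ++ cur \<sigma>) r \<and> q = Atom (at_loc L (sub_aut \<alpha> v) w'))" for q
    by (auto simp: act_Atom_flat edge_def)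
  have "act L (cfg L \<alpha> (v, Some w)) \<sigma> a p \<sigma>' \<longleftrightarrow>
     (\<exists>g r v'. (v, g, a, r, v') \<in> edges \<alpha> \<and> sat L (cur \<sigma>) g \<and> sat L (stp \<sigma>' ++ cur \<sigma>) r \<and>
        sat L (cur \<sigma>) (trm (sub_aut \<alpha> v) w) \<and> enters v' \<sigma>' p) \<or>
     (\<exists>g r w'. (w, g, a, r, w') \<in> edges (sub_aut \<alpha> v) \<and> sat L (cur \<sigma>) g \<and>
        sat L (stp \<sigma>' ++ cur \<sigma>) r \<and> p = cfg L \<alpha> (v, Some w'))"
    (is "_ \<longleftrightarrow> ?inner_outer")
    unfolding cfg_simps act_Postfix_iff using env act by blast
  also have "?inner_outer \<longleftrightarrow> (\<exists>v' x'. flat_step L \<alpha> (v, Some w) a (v', x') \<sigma> \<sigma>' \<and> p = cfg L \<alpha> (v', x'))"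
    (is "_ \<longleftrightarrow> ?steps")
  proof
    assume ?inner_outer
    then consider (outer) g r v' where "(v, g, a, r, v') \<in> edges \<alpha>" "sat L (cur \<sigma>) g"
        "sat L (stp \<sigma>' ++ cur \<sigma>) r" "sat L (cur \<sigma>) (trm (sub_aut \<alpha> v) w)" "enters v' \<sigma>' p"
      | (inner) g r w' where "(w, g, a, r, w') \<in> edges (sub_aut \<alpha> v)" "sat L (cur \<sigma>) g"
        "sat L (stp \<sigma>' ++ cur \<sigma>) r" "p = cfg L \<alpha> (v, Some w')"
      by blast
    then show ?steps
    proof cases
      case outer
      then obtain x' where "(v', x') \<in> flat_locs \<alpha>" "sat L (cur \<sigma>') (inner_pred L init \<alpha> (v', x'))"
        "p = cfg L \<alpha> (v', x')"
        using enters_iff[OF e[OF outer(1)]] by blast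
      then show ?thesis unfolding flat_step_iff inner_pred_simps using outer vw by blast
    next
      case inner
      have "(v, Some w') \<in> flat_locs \<alpha>" using e'[OF inner(1)] h by auto
      then show ?thesis unfolding flat_step_iff using inner vw by blast
    qed
  next
    assume ?steps
    then obtain v' x' where "flat_step L \<alpha> (v, Some w) a (v', x') \<sigma> \<sigma>'" and p: "p = cfg L \<alpha> (v', x')"
      by blast
    then consider (outer) g r where "(v, g, a, r, v') \<in> edges \<alpha>" "sat L (cur \<sigma>) g"
        "sat L (stp \<sigma>' ++ cur \<sigma>) r" "sat L (cur \<sigma>) (trm (sub_aut \<alpha> v) w)"
        "(v', x') \<in> flat_locs \<alpha>" "sat L (cur \<sigma>') (inner_pred L init \<alpha> (v', x'))"
      | (inner) g r w' where "(w, g, a, r, w') \<in> edges (sub_aut \<alpha> v)" "sat L (cur \<sigma>) g"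
        "sat L (stp \<sigma>' ++ cur \<sigma>) r" "v' = v" "x' = Some w'"
      unfolding flat_step_iff inner_pred_simps by blast
    then show ?inner_outer
    proof cases
      case outer
      then have "enters v' \<sigma>' p" using enters_iff[OF e[OF outer(1)]] p by blast
      then show ?thesis using outer by blast
    next
      case inner
      then show ?thesis using p by blast
    qed
  qed
  finally show ?thesis by simp
qed

section \<open>Environment transitions of the hierarchical automaton\<close>

text \<open>The right-hand side does not restrict \<open>\<sigma>'\<close>: the environment may
  change the valuation arbitrarily, and only locations, initialization and termination at
  \<open>\<sigma>\<close> count.\<close>

lemma env_Atom_presented:
  "env L (Atom \<alpha>) \<sigma> b p \<sigma>' \<longleftrightarrow> (\<exists>x\<in>flat_locs \<alpha>. sat L (cur \<sigma>) (flat_pred L init \<alpha> x) \<and>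
     b = sat L (cur \<sigma>) (flat_pred L trm \<alpha> x) \<and> p = cfg L \<alpha> x)" (is "?l \<longleftrightarrow> ?r")
proof
  assume ?l then show ?r
  proof cases
    case (Atom_sub v q b' p')
    note [simp] = sub_Some[OF Atom_sub(5)]
    obtain w where "w \<in> locs (sub_aut \<alpha> v)" "sat L (cur \<sigma>) (init (sub_aut \<alpha> v) w)"
      "b' = sat L (cur \<sigma>) (trm (sub_aut \<alpha> v) w)" "p' = Atom (at_loc L (sub_aut \<alpha> v) w)"
      using Atom_sub by (auto simp: env_Atom_flat)
    then show ?thesis using Atom_sub by (intro bexI[of _ "(v, Some w)"]) auto
  next
    case (Atom_nosub v)
    then show ?thesis by (intro bexI[of _ "(v, None)"]) auto
  qed
next
  assume ?r
  then obtain v x where x: "(v, x) \<in> flat_locs \<alpha>" "sat L (cur \<sigma>) (flat_pred L init \<alpha> (v, x))"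
     "b = sat L (cur \<sigma>) (flat_pred L trm \<alpha> (v, x))" "p = cfg L \<alpha> (v, x)" by auto
  show ?l
  proof (cases x)
    case None
    then show ?thesis using x by (auto intro: env.Atom_nosub)
  next
    case (Some w)
    then obtain h where h: "sub \<alpha> v = Some h" using x by auto
    note [simp] = sub_Some[OF h]
    have "env L h \<sigma> (sat L (cur \<sigma>) (trm (sub_aut \<alpha> v) w)) (Atom (at_loc L (sub_aut \<alpha> v) w)) \<sigma>'"
      using x Some by (auto simp: env_Atom_flat)
    then show ?thesis using x Some h by (auto intro: env.Atom_sub)
  qed
qed

lemma env_Postfix_presented:
  assumes vw: "(v, Some w) \<in> flat_locs \<alpha>"
  shows "env L (cfg L \<alpha> (v, Some w)) \<sigma> b p \<sigma>' \<longleftrightarrow>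
    b = sat L (cur \<sigma>) (flat_pred L trm \<alpha> (v, Some w)) \<and> p = cfg L \<alpha> (v, Some w)"
proof -
  obtain h where h: "sub \<alpha> v = Some h" using vw by auto
  note [simp] = sub_Some[OF h]
  show ?thesis using vw
    by (simp, subst env.simps) (auto simp: env_Atom_flat)
qed

section \<open>Time transitions of the hierarchical automaton\<close>

text \<open>Inner and outer trajectories share the interval, so \<open>the\<close> never meets
  \<open>None\<close>. The conjunction is swapped to follow \<open>flat_pred\<close>, which puts the
  outer predicate before the inner one.\<close>

lemma on_inner_cong:
  "on {0..t} (\<lambda>s. the (on {0..t} f s) \<and> g s) = on {0..t} (\<lambda>s. g s \<and> f s)"
  "on {0..t} (\<lambda>s. the (on {0..t} F s) \<union> {a \<in> G s. the (on {0..t} f s)}) =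
   on {0..t} (\<lambda>s. F s \<union> {a \<in> G s. f s})"
  by (auto simp: on_def)

text \<open>The duration is not an argument of \<open>time\<close>; it is recovered from the domain
  of \<open>\<rho>\<close>, which outer and inner step share.\<close>

lemma flow_dom_unique: "flow L \<beta> v \<rho> t \<Longrightarrow> flow L \<beta>' v' \<rho> t' \<Longrightarrow> t' = t"
  by (auto simp: flow_def)

text \<open>The \<open>init\<close> and \<open>tcp\<close> predicates of a flat location with a
  substructure are conjunctions, so a flat flow is the same as an outer and an inner flow along one
  \<open>\<rho>\<close>.\<close>

lemma time_Atom_presented:
  "time L (Atom \<alpha>) \<sigma> \<rho> \<theta> \<omega> p \<sigma>' \<longleftrightarrow>
     (\<exists>x t. flat_flow L \<alpha> (\<lambda>\<sigma> x. sat L (cur \<sigma>) (flat_pred L init \<alpha> x)) x \<rho> t \<and>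
        \<sigma> = the (\<rho> 0) \<and> \<sigma>' = the (\<rho> t) \<and>
        \<omega> = on {0..t} (\<lambda>s. sat L (cur (the (\<rho> s))) (flat_pred L trm \<alpha> x)) \<and>
        \<theta> = on {0..t} (\<lambda>s. flat_enabled L \<alpha> x (the (\<rho> s))) \<and> p = cfg L \<alpha> x)" (is "?l \<longleftrightarrow> ?r")
proof
  assume ?l then show ?r
  proof cases
    case (Atom_sub v t h \<theta>0 \<omega>0 q)
    note [simp] = sub_Some[OF Atom_sub(5)]
    obtain w where w: "flow L (sub_aut \<alpha> v) w \<rho> t"
       "\<omega>0 = on {0..t} (\<lambda>s. sat L (cur (the (\<rho> s))) (trm (sub_aut \<alpha> v) w))"
       "\<theta>0 = on {0..t} (\<lambda>s. enabled L (sub_aut \<alpha> v) w (the (\<rho> s)))"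
       "q = Atom (at_loc L (sub_aut \<alpha> v) w)"
      using Atom_sub(6) flow_dom_unique[OF Atom_sub(4)] by (auto simp: time_Atom_flat)
    have vw: "(v, Some w) \<in> flat_locs \<alpha>"
      using w(1) Atom_sub(5) by (auto simp: flow_def)
    show ?thesis using Atom_sub w(1) vw
      by (intro exI[of _ "(v, Some w)"] exI[of _ t])
        (auto simp: w(2-4) on_inner_cong flow_def flat_flow_def flat_enabled_Some)
  next
    case (Atom_nosub v t)
    then show ?thesis
      by (intro exI[of _ "(v, None)"] exI[of _ t]) (auto simp: flow_def flat_flow_def flat_enabled_None)
  qed
next
  assume ?r
  then obtain v x t where
    fl: "flat_flow L \<alpha> (\<lambda>\<sigma> x. sat L (cur \<sigma>) (flat_pred L init \<alpha> x)) (v, x) \<rho> t"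
    and [simp]: "\<sigma> = the (\<rho> 0)" "\<sigma>' = the (\<rho> t)"
      "\<omega> = on {0..t} (\<lambda>s. sat L (cur (the (\<rho> s))) (flat_pred L trm \<alpha> (v, x)))"
      "\<theta> = on {0..t} (\<lambda>s. flat_enabled L \<alpha> (v, x) (the (\<rho> s)))" "p = cfg L \<alpha> (v, x)"
    by auto
  show ?l
  proof (cases x)
    case None
    then show ?thesis using fl
      by (auto intro!: time.Atom_nosub simp: flat_flow_def flow_def flat_enabled_None)
  next
    case (Some w)
    then obtain h where h: "sub \<alpha> v = Some h" using fl by (auto simp: flat_flow_def)
    note [simp] = sub_Some[OF h]
    \<comment> \<open>The inner trajectories occur only in the premises of
      \<open>time.Atom_sub\<close>, hence are named here and supplied explicitly.\<close>
    let ?\<omega>0 = "on {0..t} (\<lambda>s. sat L (cur (the (\<rho> s))) (trm (sub_aut \<alpha> v) w))"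
    let ?\<theta>0 = "on {0..t} (\<lambda>s. enabled L (sub_aut \<alpha> v) w (the (\<rho> s)))"
    have "flow L (sub_aut \<alpha> v) w \<rho> t"
      using fl Some by (auto simp: flat_flow_def flow_def)
    then have "time L h (the (\<rho> 0)) \<rho> ?\<theta>0 ?\<omega>0 (Atom (at_loc L (sub_aut \<alpha> v) w)) (the (\<rho> t))"
      by (auto simp: time_Atom_flat)
    then show ?thesis using fl Some h
      by (auto intro!: time.Atom_sub[where h = h and ?\<omega>0.0 = ?\<omega>0 and ?\<theta>0.0 = ?\<theta>0]
          simp: on_inner_cong flat_flow_def flow_def flat_enabled_Some)
  qed
qed

lemma time_Postfix_presented:
  assumes vw: "(v, Some w) \<in> flat_locs \<alpha>"
  shows "time L (cfg L \<alpha> (v, Some w)) \<sigma> \<rho> \<theta> \<omega> p \<sigma>' \<longleftrightarrow>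
     (\<exists>x t. flat_flow L \<alpha> (\<lambda>_. (=) (v, Some w)) x \<rho> t \<and>
        \<sigma> = the (\<rho> 0) \<and> \<sigma>' = the (\<rho> t) \<and>
        \<omega> = on {0..t} (\<lambda>s. sat L (cur (the (\<rho> s))) (flat_pred L trm \<alpha> x)) \<and>
        \<theta> = on {0..t} (\<lambda>s. flat_enabled L \<alpha> x (the (\<rho> s))) \<and> p = cfg L \<alpha> x)" (is "?l \<longleftrightarrow> ?r")
proof
  obtain h where h: "sub \<alpha> v = Some h" using vw by auto
  note [simp] = sub_Some[OF h]
  {
    assume ?l
    then have "time L (Postfix (Atom (at_loc L (sub_aut \<alpha> v) w)) (at_loc L \<alpha> v)) \<sigma> \<rho> \<theta> \<omega> p \<sigma>'"
      by simp
    then show ?r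
    proof cases
      case (Postfix v' t \<theta>0 \<omega>0 p')
      \<comment> \<open>\<open>flow\<close> tests the initialization of \<open>\<alpha>[v]\<close>
        at time 0, which forces this; the inner location is forced to be \<open>w\<close> in the
        same way.\<close>
      then have [simp]: "v' = v" by (simp add: flow_def)
      from Postfix(5) obtain w' t' where wt: "flow L (at_loc L (sub_aut \<alpha> v) w) w' \<rho> t'"
         "\<omega>0 = on {0..t'} (\<lambda>s. sat L (cur (the (\<rho> s))) (trm (sub_aut \<alpha> v) w'))"
         "\<theta>0 = on {0..t'} (\<lambda>s. enabled L (sub_aut \<alpha> v) w' (the (\<rho> s)))"
         "p' = Atom (at_loc L (sub_aut \<alpha> v) w')"
        by (auto simp: time_Atom_flat)
      have "t' = t" by (rule flow_dom_unique[OF Postfix(4) wt(1)])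
      moreover have "w' = w" using wt(1) by (simp add: flow_def)
      ultimately have w: "flow L (at_loc L (sub_aut \<alpha> v) w) w \<rho> t"
         "\<omega>0 = on {0..t} (\<lambda>s. sat L (cur (the (\<rho> s))) (trm (sub_aut \<alpha> v) w))"
         "\<theta>0 = on {0..t} (\<lambda>s. enabled L (sub_aut \<alpha> v) w (the (\<rho> s)))"
         "p' = Atom (at_loc L (sub_aut \<alpha> v) w)"
        using wt by simp_all
      show ?thesis using Postfix w(1) vw
        by (intro exI[of _ "(v, Some w)"] exI[of _ t])
          (auto simp: w(2-4) on_inner_cong flow_def flat_flow_def flat_enabled_Some)
    qed
  next
    assume ?r
    then obtain t where
      fl: "flat_flow L \<alpha> (\<lambda>_. (=) (v, Some w)) (v, Some w) \<rho> t"
      and [simp]: "\<sigma> = the (\<rho> 0)" "\<sigma>' = the (\<rho> t)"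
        "\<omega> = on {0..t} (\<lambda>s. sat L (cur (the (\<rho> s))) (flat_pred L trm \<alpha> (v, Some w)))"
        "\<theta> = on {0..t} (\<lambda>s. flat_enabled L \<alpha> (v, Some w) (the (\<rho> s)))"
        "p = cfg L \<alpha> (v, Some w)"
      by (auto simp: flat_flow_def)
    let ?\<omega>0 = "on {0..t} (\<lambda>s. sat L (cur (the (\<rho> s))) (trm (sub_aut \<alpha> v) w))"
    let ?\<theta>0 = "on {0..t} (\<lambda>s. enabled L (sub_aut \<alpha> v) w (the (\<rho> s)))"
    let ?q = "Atom (at_loc L (sub_aut \<alpha> v) w)"
    have "flow L (at_loc L (sub_aut \<alpha> v) w) w \<rho> t"
      using fl by (auto simp: flat_flow_def flow_def)
    then have "time L ?q (the (\<rho> 0)) \<rho> ?\<theta>0 ?\<omega>0 ?q (the (\<rho> t))"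
      by (auto simp: time_Atom_flat)
    \<comment> \<open>The rule fixes the outer location of \<open>\<alpha>[v]\<close> once more; the
      double \<open>at_loc\<close> collapses afterwards.\<close>
    then have "time L (Postfix ?q (at_loc L \<alpha> v)) (the (\<rho> 0)) \<rho> \<theta> \<omega>
        (Postfix ?q (at_loc L (at_loc L \<alpha> v) v)) (the (\<rho> t))"
      using fl vw
      by (intro time.Postfix[where t = t and ?\<omega>0.0 = ?\<omega>0 and ?\<theta>0.0 = ?\<theta>0])
        (auto simp: on_inner_cong flat_flow_def flow_def flat_enabled_Some)
    then show ?l by simp
  }
qed

section \<open>Presentation of the states of the hierarchical automaton\<close>

lemma presents_Atom:
  "presents L \<alpha> (\<lambda>\<sigma> x. sat L (cur \<sigma>) (flat_pred L init \<alpha> x)) (cfg L \<alpha>) (Atom \<alpha>)"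
  unfolding presents_def
  by (intro conjI allI env_Atom_presented act_Atom_presented time_Atom_presented)

lemma presents_cfg:
  assumes "x \<in> flat_locs \<alpha>"
  shows "presents L \<alpha> (\<lambda>_. (=) x) (cfg L \<alpha>) (cfg L \<alpha> x)"
proof (cases x)
  case (Pair v y)
  show ?thesis
  proof (cases y)
    case None
    \<comment> \<open>Initialization of \<open>\<alpha>[v]\<close> selects the flat locations above
      \<open>v\<close>, and \<open>(v, None)\<close> is the only one, because \<open>v\<close> has
      no substructure.\<close>
    have "presents L \<alpha> (\<lambda>_. (=) x) (cfg L \<alpha>) (Atom (at_loc L \<alpha> v)) \<longleftrightarrow>
      presents L \<alpha> (\<lambda>\<sigma> x. sat L (cur \<sigma>) (flat_pred L init (at_loc L \<alpha> v) x)) (cfg L \<alpha>)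
        (Atom (at_loc L \<alpha> v))"
      using assms Pair None
      by (intro presents_cong) (auto simp: flat_locs_def)
    then show ?thesis
      using two_level.presents_Atom[OF two_level_at_loc, of v] Pair None by simp
  next
    case (Some w)
    with assms Pair have vw: "(v, Some w) \<in> flat_locs \<alpha>" by simp
    show ?thesis
      unfolding presents_def Pair Some env_Postfix_presented[OF vw] act_Postfix_presented[OF vw]
      by (intro conjI allI time_Postfix_presented[OF vw]) (use vw in blast)+
  qed
qed

lemma wf_cfg:
  assumes "x \<in> flat_locs \<alpha>"
  shows "wf_comp L (cfg L \<alpha> x)"
proof (cases x)
  case (Pair v y)
  show ?thesis
    using assms Pair lang wf sub_Some(3)
    by (cases y) (auto intro!: wf_automaton_wf_comp.intros(2,3) wf_automaton_at_loc)
qed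

section \<open>Presentation of the flattening and conclusion\<close>

text \<open>\<open>\<beta>\<close> agrees with \<open>enc\<close> except possibly in
  \<open>init\<close>, so one proof covers \<open>enc\<close> itself and \<open>enc\<close> with a
  fixed location.\<close>

lemma presents_enc:
  assumes inj: "inj enc_pair"
    and \<beta>: "locs \<beta> = enc_pair ` flat_locs \<alpha>" "sub \<beta> = Map.empty"
      "tcp \<beta> = tcp (enc L enc_pair \<alpha>)" "trm \<beta> = trm (enc L enc_pair \<alpha>)"
      "edges \<beta> = edges (enc L enc_pair \<alpha>)"
  shows "presents L \<alpha> (\<lambda>\<sigma> x. sat L (cur \<sigma>) (init \<beta> (enc_pair x)))
    (\<lambda>x. Atom (at_loc L \<beta> (enc_pair x))) (Atom \<beta>)"
proof -
  have [simp]: "tcp \<beta> (enc_pair x) = flat_pred L tcp \<alpha> x" "trm \<beta> (enc_pair x) = flat_pred L trm \<alpha> x"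
    for x using inj by (simp_all add: \<beta>(3,4) enc_def)
  have edges: "(l, g, a, r, l') \<in> edges \<beta> \<longleftrightarrow>
      (\<exists>x x'. l = enc_pair x \<and> l' = enc_pair x' \<and> (x, g, a, r, x') \<in> flat_edges L \<alpha>)" for l g a r l'
    unfolding \<beta>(5) by (force simp: enc_def)
  have [simp]: "enc_pair x = enc_pair y \<longleftrightarrow> x = y" for x y
    using inj by (simp add: inj_eq)
  have [simp]: "enabled L \<beta> (enc_pair x) \<sigma> = flat_enabled L \<alpha> x \<sigma>" for x \<sigma>
    by (auto simp: enabled_def flat_enabled_def edges)
  have [simp]: "flow L \<beta> (enc_pair x) \<rho> t \<longleftrightarrow>
      flat_flow L \<alpha> (\<lambda>\<sigma> x. sat L (cur \<sigma>) (init \<beta> (enc_pair x))) x \<rho> t" for x \<rho> t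
    by (auto simp: flow_def flat_flow_def \<beta>(1))
  \<comment> \<open>Flows run only in encoded locations, so a quantifier over locations may be
    replaced by one over pairs.\<close>
  have "l \<in> range enc_pair" if "flow L \<beta> l \<rho> t" for l \<rho> t
    using that by (auto simp: flow_def \<beta>(1))
  then have flow: "(\<exists>l t. flow L \<beta> l \<rho> t \<and> P l t) \<longleftrightarrow> (\<exists>x t. flow L \<beta> (enc_pair x) \<rho> t \<and> P (enc_pair x) t)"
    for \<rho> P by blast
  show ?thesis
    unfolding presents_def env_Atom_flat[OF \<beta>(2)] act_Atom_flat[OF \<beta>(2)] time_Atom_flat[OF \<beta>(2)] flow
    by (auto simp: \<beta>(1) edge_def flat_step_def edges; blast)
qed

lemma stateless_bisimilar_enc:
  assumes inj: "inj enc_pair"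
  shows "stateless_bisimilar L (Atom \<alpha>) (Atom (enc L enc_pair \<alpha>))"
proof (rule stateless_bisimulation_presents)
  let ?e = "enc L enc_pair \<alpha>"
  let ?d = "\<lambda>x. Atom (at_loc L ?e (enc_pair x))"
  have e: "locs ?e = enc_pair ` flat_locs \<alpha>" "sub ?e = Map.empty"
    by (simp_all add: enc_def)
  show "presents L \<alpha> (\<lambda>_. (=) x) (cfg L \<alpha>) (cfg L \<alpha> x) \<and> wf_comp L (cfg L \<alpha> x)"
    if "x \<in> flat_locs \<alpha>" for x
    using that presents_cfg wf_cfg by blast
  \<comment> \<open>With the location fixed to \<open>enc_pair x\<close>, initialization at
    \<open>enc_pair y\<close> says that the two encodings coincide, i.e. \<open>x = y\<close> by
    injectivity.\<close>
  show "presents L \<alpha> (\<lambda>_. (=) x) ?d (?d x) \<and> wf_comp L (?d x)" for x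
    using presents_enc[OF inj, of "at_loc L ?e (enc_pair x)"] e
      wf_automaton_at_loc[OF lang wf_enc[OF inj]] inj
    by (auto simp: inj_eq intro: wf_automaton_wf_comp.intros(2))
  show "presents L \<alpha> (\<lambda>\<sigma> x. sat L (cur \<sigma>) (flat_pred L init \<alpha> x)) (cfg L \<alpha>) (Atom \<alpha>)"
    by (rule presents_Atom)
  \<comment> \<open>Hence \<open>enc\<close> and \<open>\<alpha>\<close> may start in the same flat
    locations at every valuation, as a common \<open>I\<close> demands.\<close>
  have "init ?e (enc_pair x) = flat_pred L init \<alpha> x" for x
    using inj by (simp add: enc_def)
  then show "presents L \<alpha> (\<lambda>\<sigma> x. sat L (cur \<sigma>) (flat_pred L init \<alpha> x)) ?d (Atom ?e)"
    using presents_enc[OF inj, of ?e] e by simp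
  show "wf_comp L (Atom \<alpha>)" "wf_comp L (Atom ?e)"
    using wf wf_enc[OF inj] by (auto intro: wf_automaton_wf_comp.intros(2))
qed

end

theorem theorem2:
  fixes L :: "('l, 'x, 'v, 'e) pred_lang"
    and enc_pair :: "'l \<times> 'l option \<Rightarrow> 'l"
    and \<alpha> :: "('l, 'a, 'e) automaton"
  assumes "predicate_language L"
    and "inj enc_pair"
    and "wf_automaton L \<alpha>"
    and "depth (Atom \<alpha>) = 2"
    and "\<forall>v\<in>dom (sub \<alpha>). \<exists>\<beta>. sub \<alpha> v = Some (Atom \<beta>) \<and> flat \<beta>"
  shows "stateless_bisimilar L (Atom \<alpha>) (Atom (enc L enc_pair \<alpha>))"
proof -
  interpret two_level L \<alpha> using assms by unfold_locales
  show ?thesis using assms(2) by (rule stateless_bisimilar_enc)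
qed

end
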